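(* Let $0\le \beta<1$ and let $\nu$ be real. Then the following assertions are true. (a) If $\nu\in(-1,0)$, then $r^*_\beta(f_\nu)=x_{\nu,\beta}$, where $x_{\nu,\beta}$ denotes the unique positive root of the equation $zI_\nu'(z)-\beta\nu I_\nu(z)=0$. Moreover, if $\nu>0$, then $r^*_\beta(f_\nu)=x_{\nu,\beta,1}$, where $x_{\nu,\beta,1}$ is the smallest positive root of the equation $zJ_\nu'(z)-\beta\nu J_\nu(z)=0$. (b) If $\nu>-1$, then $r^*_\beta(g_\nu)=y_{\nu,\beta,1}$, where $y_{\nu,\beta,1}$ is the smallest positive root of the equation $zJ_\nu'(z)+(1-\beta-\nu)J_\nu(z)=0$. (c) If $\nu>-1$, then $r^*_\beta(h_\nu)=z_{\nu,\beta,1}$, where $z_{\nu,\beta,1}$ is the smallest positive root of the equation $zJ_\nu'(z)+(2-2\beta-\nu)J_\nu(z)=0$.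
   Context: $\mathbf{D}(0,r)=\{z\in\mathbb{C}:|z|<r\}$. $J_\nu$ is the Bessel function of the first kind, $$J_\nu(z)=\sum_{n\ge 0}\frac{(-1)^n}{n!\,\Gamma(n+\nu+1)}\left(\frac z2\right)^{2n+\nu},$$ and $I_\nu$ is the modified Bessel function of the first kind, $$I_\nu(z)=\sum_{n\ge 0}\frac{1}{n!\,\Gamma(n+\nu+1)}\left(\frac z2\right)^{2n+\nu}$$ (formally $I_\nu(z)=\mathrm{i}^{-\nu}J_\nu(\mathrm{i}z)$). For real $\nu>-1$ all zeros of the entire function $z\mapsto z^{-\nu}J_\nu(z)$ are real, and $j_{\nu,1}$ denotes the smallest positive zero of $J_\nu$. The normalized Bessel functions are $$f_\nu(z)=\left[2^\nu\Gamma(\nu+1)J_\nu(z)\right]^{1/\nu}\ (\nu\ne 0),\quad g_\nu(z)=2^\nu\Gamma(\nu+1)z^{1-\nu}J_\nu(z),\quad h_\nu(z)=2^\nu\Gamma(\nu+1)z^{1-\nu/2}J_\nu(\sqrt z).$$ All three are normalized analytic functions near $0$: $f(0)=0$, $f'(0)=1$. The functions $g_\nu$ and $h_\nu$ are understood as entire functions (the powers of $z$ cancel): $g_\nu(z)=z\Lambda_\nu(z)$ with $\Lambda_\nu(z)=2^\nu\Gamma(\nu+1)z^{-\nu}J_\nu(z)$ (entire and even, $\Lambda_\nu(0)=1$), and $h_\nu(z)=z\Lambda_\nu(\sqrt z)$. The function $f_\nu$ is understood as $f_\nu(z)=z\,[\Lambda_\nu(z)]^{1/\nu}=z\exp\left(\frac1\nu\log\Lambda_\nu(z)\right)$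 on $\mathbf{D}(0,j_{\nu,1})$, where $\log\Lambda_\nu$ is the analytic branch vanishing at $0$; in particular $zf_\nu'(z)/f_\nu(z)=\frac1\nu\, zJ_\nu'(z)/J_\nu(z)$. For a function $f$ analytic near $0$ with $f(0)=f'(0)-1=0$ and $\beta\in[0,1)$, the radius of starlikeness of order $\beta$ is $$r^*_\beta(f)=\sup\left\{r>0:\ \operatorname{Re}\left[\frac{zf'(z)}{f(z)}\right]>\beta\ \text{ for all } z\in\mathbf{D}(0,r)\right\},$$ where $zf'(z)/f(z)$ is given its limiting value $1$ at $z=0$, and the condition for a given $r$ includes that $f$ is analytic in $\mathbf{D}(0,r)$ and nonvanishing there except at $0$ (the radius may be larger or smaller than $1$).
   Formalization: Part (c) is corrected: the radius of starlikeness of h_ν is the square of z_{ν,β,1}, since the equation is solved in the variable √z; as printed it fails, e.g. for ν=1/2, β=0, where the root is about 2.029 but the radius is about 4.116. *)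

theory Defs
  imports "HOL-Complex_Analysis.Complex_Analysis"
begin

text \<open>
  Powers are principal. In the library \<open>0 powr 0 = 0\<close>; the case distinction makes the
  leading term of the Bessel series of order 0 equal to 1 at the origin.
\<close>
definition cpower :: "complex \<Rightarrow> complex \<Rightarrow> complex" where
  "cpower z a = (if a = 0 then 1 else z powr a)"

definition bessel_J :: "real \<Rightarrow> complex \<Rightarrow> complex" where
  "bessel_J \<nu> z = (\<Sum>n. (- 1) ^ n / (fact n * Gamma (of_nat n + of_real \<nu> + 1))
                        * cpower (z / 2) (of_nat (2 * n) + of_real \<nu>))"

definition bessel_I :: "real \<Rightarrow> complex \<Rightarrow> complex" where
  "bessel_I \<nu> z = (\<Sum>n. 1 / (fact n * Gamma (of_nat n + of_real \<nu> + 1))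
                        * cpower (z / 2) (of_nat (2 * n) + of_real \<nu>))"

definition pos_root :: "(complex \<Rightarrow> complex) \<Rightarrow> real \<Rightarrow> bool" where
  "pos_root F x \<longleftrightarrow> 0 < x \<and> F (of_real x) = 0"

definition unique_pos_root :: "(complex \<Rightarrow> complex) \<Rightarrow> real \<Rightarrow> bool" where
  "unique_pos_root F x \<longleftrightarrow> pos_root F x \<and> (\<forall>y. pos_root F y \<longrightarrow> y = x)"

definition smallest_pos_root :: "(complex \<Rightarrow> complex) \<Rightarrow> real \<Rightarrow> bool" where
  "smallest_pos_root F x \<longleftrightarrow> pos_root F x \<and> (\<forall>y. pos_root F y \<longrightarrow> x \<le> y)"

definition bessel_zero1 :: "real \<Rightarrow> real" where
  "bessel_zero1 \<nu> = (THE x. smallest_pos_root (bessel_J \<nu>) x)"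

text \<open>
  The branch jumps of \<open>z powr - \<nu>\<close> and \<open>bessel_J \<nu> z\<close> on the negative real axis cancel
  exactly, so this is the entire function \<open>\<Lambda>\<close> itself; see the power series below.
\<close>
definition bessel_Lambda :: "real \<Rightarrow> complex \<Rightarrow> complex" where
  "bessel_Lambda \<nu> z = (if z = 0 then 1 else
     2 powr of_real \<nu> * Gamma (of_real \<nu> + 1) * z powr (- of_real \<nu>) * bessel_J \<nu> z)"

definition log_bessel_Lambda :: "real \<Rightarrow> complex \<Rightarrow> complex" where
  "log_bessel_Lambda \<nu> = (SOME L. L holomorphic_on ball 0 (bessel_zero1 \<nu>) \<and> L 0 = 0 \<and>
     (\<forall>z\<in>ball 0 (bessel_zero1 \<nu>). exp (L z) = bessel_Lambda \<nu> z))"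

text \<open>The value 0 outside the disc is a dummy; \<open>f\<close> is only considered inside.\<close>
definition bessel_f :: "real \<Rightarrow> complex \<Rightarrow> complex" where
  "bessel_f \<nu> z = (if z \<in> ball 0 (bessel_zero1 \<nu>)
     then z * exp (1 / of_real \<nu> * log_bessel_Lambda \<nu> z) else 0)"

definition bessel_g :: "real \<Rightarrow> complex \<Rightarrow> complex" where
  "bessel_g \<nu> z = z * bessel_Lambda \<nu> z"

text \<open>
  Because \<open>\<Lambda>\<close> is even, \<open>h\<close> is entire. Here \<open>J\<close> is evaluated at \<open>sqrt z\<close>, so a point of the
  \<open>z\<close>-plane corresponds to the square of an argument of \<open>J\<close>: the starlikeness radius of \<open>h\<close>
  is the square of a root of an equation in the argument of \<open>J\<close>. For instance
  \<open>h z = sqrt z * sin (sqrt z)\<close> for order 1/2, whose radius of starlikeness (\<open>\<beta> = 0\<close>) is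
  4.1158... = y^2, where y = 2.0287... is the smallest positive root of
  \<open>z * J' z + 3 / 2 * J z = 0\<close>, that is, of \<open>sin z + z * cos z = 0\<close>.
\<close>
definition bessel_h :: "real \<Rightarrow> complex \<Rightarrow> complex" where
  "bessel_h \<nu> z = z * bessel_Lambda \<nu> (csqrt z)"

definition starlike_on_disc :: "real \<Rightarrow> (complex \<Rightarrow> complex) \<Rightarrow> real \<Rightarrow> bool" where
  "starlike_on_disc \<beta> f r \<longleftrightarrow>
     f analytic_on ball 0 r \<and>
     (\<forall>z\<in>ball 0 r - {0}. f z \<noteq> 0) \<and>
     (\<forall>z\<in>ball 0 r. Re (if z = 0 then 1 else z * deriv f z / f z) > \<beta>)"

text \<open>The supremum is taken in the extended reals, as it may be infinite for a general \<open>f\<close>.\<close>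
definition starlike_radius :: "real \<Rightarrow> (complex \<Rightarrow> complex) \<Rightarrow> ereal" where
  "starlike_radius \<beta> f = (SUP r \<in> {r. 0 < r \<and> starlike_on_disc \<beta> f r}. ereal r)"

lemma bessel_series_summable:
  fixes w :: complex
  assumes "\<nu> > -1"
  shows "summable (\<lambda>n. (- 1) ^ n / (fact n * Gamma (of_nat n + of_real \<nu> + 1)) * w ^ (2 * n))"
    (is "summable ?a")
proof -
  obtain N :: nat where N: "2 * norm w ^ 2 / (1 + \<nu>) \<le> real N"
    using real_arch_simple by blast
  show ?thesis
  proof (rule summable_ratio_test[of "1 / 2" N])
    fix n assume n: "N \<le> n"
    define R where "R k = norm (rGamma (of_nat k + of_real \<nu> + 1 :: complex))" for k
    define q where "q = norm w ^ 2"
    have na: "norm (?a k) = R k / fact k * q ^ k" for k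
      by (simp add: R_def q_def norm_mult norm_divide norm_power rGamma_inverse_Gamma
            norm_inverse power_mult divide_simps)
    have "norm (of_nat n + of_real \<nu> + 1 :: complex) = real n + \<nu> + 1"
    proof -
      have "of_nat n + of_real \<nu> + 1 = (of_real (real n + \<nu> + 1) :: complex)" by simp
      then show ?thesis using assms by (simp only: norm_of_real)
    qed
    then have R: "R n = (real n + \<nu> + 1) * R (Suc n)"
      using rGamma_plus1[of "of_nat n + of_real \<nu> + 1 :: complex"]
      by (simp add: R_def add_ac flip: norm_mult) (metis norm_mult)
    have "2 * q \<le> real N * (1 + \<nu>)"
      using N assms by (simp add: q_def field_simps)
    also have "\<dots> \<le> (real n + 1) * (real n + \<nu> + 1)"
      using n assms by (intro mult_mono) auto
    finally have q: "2 * q \<le> (real n + 1) * (real n + \<nu> + 1)" .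
    have "R (Suc n) / fact (Suc n) * q ^ Suc n = q * (R (Suc n) * q ^ n / fact (Suc n))"
      by simp
    also have "\<dots> \<le> (real n + 1) * (real n + \<nu> + 1) / 2 * (R (Suc n) * q ^ n / fact (Suc n))"
      using q by (intro mult_right_mono) (auto simp: R_def q_def)
    also have "\<dots> = 1 / 2 * (R n / fact n * q ^ n)"
      by (simp add: R divide_simps)
    finally show "norm (?a (Suc n)) \<le> 1 / 2 * norm (?a n)"
      unfolding na .
  qed simp
qed

lemma bessel_Lambda_series:
  assumes "\<nu> > -1"
  shows "bessel_Lambda \<nu> z =
    (\<Sum>n. Gamma (of_real \<nu> + 1) * ((- 1) ^ n / (fact n * Gamma (of_nat n + of_real \<nu> + 1))
          * (z / 2) ^ (2 * n)))"
proof (cases "z = 0")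
  case True
  have "Gamma (of_real \<nu> + 1 :: complex) \<noteq> 0"
  proof -
    have "of_real \<nu> + 1 = (of_real (\<nu> + 1) :: complex)" by simp
    moreover have "Gamma (\<nu> + 1) > 0" using assms by (intro Gamma_real_pos) auto
    ultimately show ?thesis by (metis Gamma_complex_of_real less_irrefl of_real_eq_0_iff)
  qed
  then show ?thesis using True
    by (subst suminf_finite[of "{0}"]) (auto simp: bessel_Lambda_def)
next
  case False
  define a where "a n = (- 1) ^ n / (fact n * Gamma (of_nat n + of_real \<nu> + 1)) * (z / 2) ^ (2 * n)"
    for n
  define d where "d = (z / 2) powr of_real \<nu>"
  have summ: "summable a"
    unfolding a_def by (rule bessel_series_summable[OF assms])
  have Ln2: "Ln (z / 2) = Ln z - Ln 2"
    using False Ln_divide_of_real[of 2 z] Ln_of_real[of 2] by simp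
  have pw: "cpower (z / 2) (of_nat (2 * n) + of_real \<nu>) = (z / 2) ^ (2 * n) * d" for n
  proof -
    have "cpower (z / 2) (of_nat (2 * n) + of_real \<nu>) = (z / 2) powr (of_nat (2 * n) + of_real \<nu>)"
      using False by (simp add: cpower_def)
    also have "\<dots> = (z / 2) powr of_nat (2 * n) * d"
      unfolding d_def by (rule powr_add)
    also have "(z / 2) powr of_nat (2 * n) = (z / 2) ^ (2 * n)"
      by (rule powr_nat') (use False in auto)
    finally show ?thesis .
  qed
  have d: "2 powr of_real \<nu> * z powr (- of_real \<nu>) * d = 1"
    using False unfolding d_def by (simp add: powr_def Ln2 algebra_simps flip: exp_add)
  have "bessel_J \<nu> z = (\<Sum>n. a n * d)"
    unfolding bessel_J_def a_def by (simp only: pw mult.assoc)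
  also have "\<dots> = suminf a * d"
    using suminf_mult2[OF summ] by simp
  finally have "bessel_Lambda \<nu> z =
      Gamma (of_real \<nu> + 1) * suminf a * (2 powr of_real \<nu> * z powr (- of_real \<nu>) * d)"
    using False by (simp add: bessel_Lambda_def mult_ac)
  also have "\<dots> = (\<Sum>n. Gamma (of_real \<nu> + 1) * a n)"
    using suminf_mult[OF summ] by (simp add: d)
  finally show ?thesis by (simp add: a_def)
qed

end

theory Submission
  imports Defs
begin

text \<open>
  Write \<open>\<Lambda>(z) = \<phi>(z^2)\<close>, \<open>D = w d/dw\<close> and \<open>p = - D \<phi> / \<phi>\<close>, so that \<open>z \<Lambda>'(z) / \<Lambda>(z) = - 2 p(z^2)\<close>. Bessel's
  equation becomes the Riccati equation \<open>D p + \<nu> p = p^2 + w / 4\<close>, which replaces the partial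
  fraction expansion of \<open>p\<close> throughout.

  Comparing coefficients, the power series of \<open>p\<close> has positive coefficients that grow at least
  geometrically. Hence \<open>\<phi>\<close> has a zero, the zero \<open>R\<close> of smallest modulus is positive, and
  \<open>Re p(w) \<le> p(|w|)\<close> for \<open>|w| < R\<close>; this settles \<open>g\<close>, \<open>h\<close>, and \<open>f\<close> for positive order.

  For \<open>-1 < \<nu> < 0\<close> a lower bound on \<open>Re p\<close> is needed instead. Bessel's equation shows \<open>Im p > 0\<close> on the
  upper half of the disc, so \<open>Im (D p) = Im p (2 Re p - \<nu>) + Im w / 4\<close> is positive there as long
  as \<open>Re p \<ge> \<nu> / 2\<close>. Since \<open>- Im (D p)\<close> is the angular derivative of \<open>Re p\<close>, on the first circle where
  \<open>Re p\<close> reaches a level \<open>- \<kappa> \<ge> \<nu> / 2\<close> it does so on the negative axis, that is, for imaginary \<open>z\<close>.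
\<close>

section \<open>The radius of starlikeness from one disc and one boundary point\<close>

text \<open>The disc of radius \<open>x\<close> is admissible, which bounds the supremum from below.
  Every larger disc contains \<open>z0\<close>, where the inequality fails.\<close>

lemma starlike_radius_eqI:
  assumes x: "0 < x" and holo: "f holomorphic_on ball 0 x"
    and disc: "\<And>z. norm z < x \<Longrightarrow> z \<noteq> 0 \<Longrightarrow> f z \<noteq> 0 \<and> \<beta> < Re (z * deriv f z / f z)"
    and "\<beta> < 1"
    and z0: "norm z0 = x" "Re (z0 * deriv f z0 / f z0) \<le> \<beta>"
  shows "starlike_radius \<beta> f = ereal x"
  unfolding starlike_radius_def
proof (rule antisym)
  have "starlike_on_disc \<beta> f x"
    using assms by (auto simp: starlike_on_disc_def analytic_on_open)
  then show "ereal x \<le> (SUP r \<in> {r. 0 < r \<and> starlike_on_disc \<beta> f r}. ereal r)"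
    using x by (intro SUP_upper) auto
  show "(SUP r \<in> {r. 0 < r \<and> starlike_on_disc \<beta> f r}. ereal r) \<le> ereal x"
  proof (rule SUP_least)
    fix r assume r: "r \<in> {r. 0 < r \<and> starlike_on_disc \<beta> f r}"
    show "ereal r \<le> ereal x"
    proof (rule ccontr)
      assume "\<not> ereal r \<le> ereal x"
      then have "z0 \<in> ball 0 r" using z0 by simp
      then have "\<beta> < Re (if z0 = 0 then 1 else z0 * deriv f z0 / f z0)"
        using r unfolding starlike_on_disc_def by blast
      then show False using z0 x by (auto split: if_splits)
    qed
  qed
qed

section \<open>Power series with nonnegative coefficients\<close>

text \<open>The first bound is the termwise triangle inequality. For the second, every term of the
  difference series is nonnegative and the linear one is positive.\<close>

lemma eval_fps_nonneg_coeffs: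
  fixes A :: "complex fps" and a :: "nat \<Rightarrow> real"
  assumes coeff: "\<And>k. fps_nth A k = of_real (a k)" and nonneg: "\<And>k. 0 \<le> a k"
  shows "norm w < fps_conv_radius A \<Longrightarrow> norm (eval_fps A w) \<le> Re (eval_fps A (of_real (norm w)))"
    and "0 \<le> r \<Longrightarrow> r < r' \<Longrightarrow> ereal r' < fps_conv_radius A \<Longrightarrow> 0 < a 1 \<Longrightarrow>
      Re (eval_fps A (of_real r)) < Re (eval_fps A (of_real r'))"
proof -
  have sums: "(\<lambda>k. a k * r ^ k) sums Re (eval_fps A (of_real r))"
    if "0 \<le> r" "ereal r < fps_conv_radius A" for r
    using sums_Re[OF sums_eval_fps[of "of_real r" A]] that
    by (simp add: coeff Re_complex_of_real flip: of_real_power of_real_mult)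
  show "norm (eval_fps A w) \<le> Re (eval_fps A (of_real (norm w)))" if "norm w < fps_conv_radius A"
  proof -
    have "norm (eval_fps A w) \<le> (\<Sum>k. norm (fps_nth A k * w ^ k))"
      unfolding eval_fps_def by (rule summable_norm) (rule norm_summable_fps[OF that])
    also have "\<dots> = Re (eval_fps A (of_real (norm w)))"
      using sums[of "norm w"] that
      by (simp add: coeff norm_mult norm_power nonneg sums_iff)
    finally show ?thesis .
  qed
  show "Re (eval_fps A (of_real r)) < Re (eval_fps A (of_real r'))"
    if r: "0 \<le> r" "r < r'" "ereal r' < fps_conv_radius A" and "0 < a 1"
  proof -
    have "ereal r < fps_conv_radius A"
      using r by (metis ereal_less_eq(3) less_imp_le order.strict_trans1)
    then have diff: "(\<lambda>k. a k * r' ^ k - a k * r ^ k) sums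
        (Re (eval_fps A (of_real r')) - Re (eval_fps A (of_real r)))"
      using r by (intro sums_diff sums) auto
    have "0 < (\<Sum>k. a k * r' ^ k - a k * r ^ k)"
    proof (rule suminf_pos2[of _ 1])
      show "summable (\<lambda>k. a k * r' ^ k - a k * r ^ k)"
        using diff by (rule sums_summable)
      show "0 \<le> a k * r' ^ k - a k * r ^ k" for k
        using nonneg r by (simp add: mult_left_mono power_mono)
      show "0 < a 1 * r' ^ 1 - a 1 * r ^ 1"
        using r \<open>0 < a 1\<close> by simp
    qed
    then show ?thesis
      using sums_unique[OF diff] by simp
  qed
qed

section \<open>The entire function \<open>\<phi>\<close> with \<open>\<Lambda>(z) = \<phi>(z^2)\<close>\<close>

locale bessel_order =
  fixes \<nu> :: real
  assumes order: "-1 < \<nu>"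
begin

text \<open>Moduli of the Taylor coefficients of \<open>phi\<close>. The quotient of Gamma values is
  written as a Pochhammer symbol, which makes positivity and the one-step recursion immediate;
  \<open>coef_Gamma\<close> leads back to the Bessel series.\<close>

definition coef :: "nat \<Rightarrow> real" where
  "coef n = 1 / (4 ^ n * fact n * pochhammer (\<nu> + 1) n)"

definition phi_fps :: "complex fps" where
  "phi_fps = Abs_fps (\<lambda>n. of_real ((-1) ^ n * coef n))"

definition phi :: "complex \<Rightarrow> complex" where
  "phi = eval_fps phi_fps"

definition dphi :: "complex \<Rightarrow> complex" where
  "dphi = eval_fps (fps_deriv phi_fps)"

lemma coef_pos: "0 < coef n"
  using order by (simp add: coef_def pochhammer_pos)

lemma coef_0: "coef 0 = 1"
  by (simp add: coef_def)

lemma coef_Suc: "4 * (real n + 1) * (real n + 1 + \<nu>) * coef (Suc n) = coef n"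
proof -
  have "pochhammer (\<nu> + 1) n > 0" "real n + 1 + \<nu> > 0"
    using order by (auto intro: pochhammer_pos)
  then show ?thesis
    by (simp add: coef_def pochhammer_Suc divide_simps) (simp add: algebra_simps)
qed

lemma coef_Gamma:
  "of_real (coef n) = Gamma (of_real \<nu> + 1) / (4 ^ n * fact n * Gamma (of_nat n + of_real \<nu> + 1 :: complex))"
proof -
  have "\<nu> + 1 \<notin> \<int>\<^sub>\<le>\<^sub>0"
    using order nonpos_Ints_nonpos by fastforce
  then have "pochhammer (\<nu> + 1) n = Gamma (real n + \<nu> + 1) / Gamma (\<nu> + 1)"
    by (simp add: pochhammer_Gamma add_ac)
  then have "coef n = Gamma (\<nu> + 1) / (4 ^ n * fact n * Gamma (real n + \<nu> + 1))"
    by (simp add: coef_def)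
  then have "complex_of_real (coef n) =
      of_real (Gamma (\<nu> + 1)) / (4 ^ n * fact n * of_real (Gamma (real n + \<nu> + 1)))"
    by simp
  then show ?thesis
    unfolding Gamma_complex_of_real[symmetric] by simp
qed

lemma phi_fps_nth: "fps_nth phi_fps n = (-1) ^ n * of_real (coef n)"
  by (simp add: phi_fps_def)

text \<open>Written at \<open>csqrt w\<close>, the terms are constant multiples of those of the
  Bessel series, so convergence at every \<open>w\<close> carries over.\<close>

lemma phi_term: "fps_nth phi_fps n * w ^ n =
    Gamma (of_real \<nu> + 1) * ((- 1) ^ n / (fact n * Gamma (of_nat n + of_real \<nu> + 1)) * (csqrt w / 2) ^ (2 * n))"
  by (simp add: phi_fps_nth coef_Gamma power_mult power_divide) (simp add: mult_ac)

lemma conv_radius_phi [simp]: "fps_conv_radius phi_fps = \<infinity>"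
  unfolding fps_conv_radius_def
proof (rule conv_radius_inftyI'')
  show "summable (\<lambda>n. fps_nth phi_fps n * w ^ n)" for w
    unfolding phi_term by (intro summable_mult bessel_series_summable[OF order])
qed

lemma conv_radius_dphi [simp]: "fps_conv_radius (fps_deriv phi_fps) = \<infinity>"
  using fps_conv_radius_deriv[of phi_fps] by simp

lemma Lambda_eq_phi: "bessel_Lambda \<nu> z = phi (z\<^sup>2)"
  by (simp add: bessel_Lambda_series[OF order] phi_def eval_fps_def phi_fps_nth coef_Gamma
      power_mult power_divide) (simp add: mult_ac)

lemma DERIV_phi [derivative_intros]:
  "(g has_field_derivative g') (at z within S) \<Longrightarrow>
    ((\<lambda>z. phi (g z)) has_field_derivative dphi (g z) * g') (at z within S)"
  unfolding phi_def dphi_def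
  by (rule DERIV_chain2[OF has_field_derivative_eval_fps]) auto

section \<open>Bessel's equation in the variable \<open>w = z^2\<close>\<close>

text \<open>Bessel's equation after the substitution \<open>w = z^2\<close> and removal of the power
  of \<open>z\<close>; coefficientwise it is \<open>coef_Suc\<close>.\<close>

lemma phi_ode_fps:
  "fps_X * fps_deriv (fps_deriv phi_fps) +
     (fps_const (of_real (1 + \<nu>)) * fps_deriv phi_fps + fps_const (1 / 4) * phi_fps) = 0"
proof (rule fps_ext)
  fix n
  have "of_real (4 * (real n + 1) * (real n + 1 + \<nu>) * coef (Suc n)) = (of_real (coef n) :: complex)"
    by (simp only: coef_Suc)
  then have "of_real (coef n) = 4 * (of_nat n + 1) * (of_nat n + 1 + of_real \<nu>) * complex_of_real (coef (Suc n))"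
    by simp
  then show "fps_nth (fps_X * fps_deriv (fps_deriv phi_fps) +
     (fps_const (of_real (1 + \<nu>)) * fps_deriv phi_fps + fps_const (1 / 4) * phi_fps)) n = fps_nth 0 n"
    by (cases n) (simp_all add: phi_fps_nth, simp_all add: algebra_simps)
qed

lemma eval_phi_ode: "dphi w + w * eval_fps (fps_deriv (fps_deriv phi_fps)) w = - (\<nu> * dphi w + phi w / 4)"
proof -
  have r: "fps_conv_radius (fps_deriv (fps_deriv phi_fps)) = \<infinity>"
    using fps_conv_radius_deriv[of "fps_deriv phi_fps"] by simp
  have m: "fps_conv_radius (g * f) = \<infinity>" if "fps_conv_radius g = \<infinity>" "fps_conv_radius f = \<infinity>"
    for f g :: "complex fps"
    using fps_conv_radius_mult[of g f] that by simp
  have a: "fps_conv_radius (f + g) = \<infinity>" if "fps_conv_radius f = \<infinity>" "fps_conv_radius g = \<infinity>"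
    for f g :: "complex fps"
    using fps_conv_radius_add[of f g] that by simp
  have "w * eval_fps (fps_deriv (fps_deriv phi_fps)) w + ((1 + \<nu>) * dphi w + phi w / 4) = 0"
    using arg_cong[OF phi_ode_fps, of "\<lambda>f. eval_fps f w"]
    by (simp add: eval_fps_mult eval_fps_add r m a phi_def dphi_def del: fps_const_add)
  then show ?thesis
    by (simp add: algebra_simps) algebra
qed

text \<open>The left side of \<open>eval_phi_ode\<close> is the derivative of
  \<open>w * dphi w\<close>, so differentiating that product brings in only \<open>phi\<close> and
  \<open>dphi\<close>, never a second derivative.\<close>

lemma DERIV_Dphi [derivative_intros]:
  "(g has_field_derivative g') (at z within S) \<Longrightarrow>
    ((\<lambda>z. g z * dphi (g z)) has_field_derivative - (\<nu> * dphi (g z) + phi (g z) / 4) * g') (at z within S)"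
proof -
  assume g: "(g has_field_derivative g') (at z within S)"
  have "((\<lambda>z. dphi (g z)) has_field_derivative eval_fps (fps_deriv (fps_deriv phi_fps)) (g z) * g') (at z within S)"
    unfolding dphi_def by (rule DERIV_chain2[OF has_field_derivative_eval_fps g]) auto
  from DERIV_mult[OF g this]
  show ?thesis
    unfolding eval_phi_ode[symmetric] by (rule DERIV_cong) (simp add: algebra_simps)
qed

lemma continuous_phi [continuous_intros]:
  "continuous_on S g \<Longrightarrow> continuous_on S (\<lambda>x. phi (g x))"
  unfolding phi_def by (rule continuous_on_eval_fps') auto

lemma continuous_dphi [continuous_intros]:
  "continuous_on S g \<Longrightarrow> continuous_on S (\<lambda>x. dphi (g x))"
  unfolding dphi_def by (rule continuous_on_eval_fps') auto

lemma holomorphic_phi: "phi holomorphic_on S"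
  unfolding phi_def by (rule holomorphic_on_eval_fps) auto

lemma holomorphic_dphi: "dphi holomorphic_on S"
  unfolding dphi_def by (rule holomorphic_on_eval_fps) auto

lemma phi_0 [simp]: "phi 0 = 1"
  by (simp add: phi_def eval_fps_at_0 phi_fps_nth coef_0)

lemma cnj_phi: "phi (cnj w) = cnj (phi w)" and cnj_dphi: "dphi (cnj w) = cnj (dphi w)"
proof -
  have "eval_fps F (cnj w) = cnj (eval_fps F w)"
    if "\<And>n. cnj (fps_nth F n) = fps_nth F n" "fps_conv_radius F = \<infinity>" for F
  proof -
    have "(\<lambda>n. cnj (fps_nth F n * w ^ n)) sums cnj (eval_fps F w)"
      by (intro sums_cnj[THEN iffD2] sums_eval_fps) (simp add: that)
    then show ?thesis
      by (simp add: eval_fps_def that sums_iff)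
  qed
  then show "phi (cnj w) = cnj (phi w)" "dphi (cnj w) = cnj (dphi w)"
    unfolding phi_def dphi_def by (simp_all add: phi_fps_nth)
qed

section \<open>The logarithmic derivative\<close>

definition p_fps :: "complex fps" where
  "p_fps = - (fps_X * fps_deriv phi_fps * inverse phi_fps)"

definition p :: "complex \<Rightarrow> complex" where
  "p w = - (w * dphi w / phi w)"

text \<open>For \<open>k \<ge> 1\<close> these are classically the Rayleigh sums, the sums of
  \<open>j^(-2k)\<close> over the positive zeros \<open>j\<close> of \<open>bessel_J \<nu>\<close>.
  Taking the real part gives a real sequence before \<open>p_fps_real\<close> shows that nothing is
  lost.\<close>

definition rayleigh :: "nat \<Rightarrow> real" where
  "rayleigh k = Re (fps_nth p_fps k)"

lemma phi_fps_inverse: "phi_fps * inverse phi_fps = 1" "phi_fps \<noteq> 0"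
proof -
  have "fps_nth phi_fps 0 = 1"
    by (simp add: phi_fps_nth coef_0)
  then show "phi_fps * inverse phi_fps = 1" "phi_fps \<noteq> 0"
    by (auto simp: inverse_mult_eq_1' )
qed

lemma p_fps_mult: "p_fps * phi_fps = - (fps_X * fps_deriv phi_fps)"
  using phi_fps_inverse unfolding p_fps_def by (simp add: mult_ac)

lemma riccati_fps:
  "fps_X * fps_deriv p_fps + fps_const (of_real \<nu>) * p_fps = p_fps ^ 2 + fps_const (1 / 4) * fps_X"
proof -
  define F where "F = phi_fps"
  define c where "c = fps_const (complex_of_real \<nu>)"
  define q where "q = fps_const (1 / 4 :: complex)"
  have "fps_deriv (p_fps * F) = - (fps_deriv F + fps_X * fps_deriv (fps_deriv F))"
    unfolding p_fps_mult F_def by (simp add: algebra_simps)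
  then have 1: "fps_deriv p_fps * F + p_fps * fps_deriv F = - (fps_deriv F + fps_X * fps_deriv (fps_deriv F))"
    by (simp add: algebra_simps)
  have 2: "fps_X * fps_deriv (fps_deriv F) + ((1 + c) * fps_deriv F + q * F) = 0"
    using phi_ode_fps unfolding F_def c_def q_def by (simp add: fps_const_add[symmetric] del: fps_const_add)
  have 3: "p_fps * F = - (fps_X * fps_deriv F)"
    using p_fps_mult by (simp add: F_def)
  \<comment> \<open>The derivative of \<open>p_fps\<close> is eliminated through \<open>1\<close>
    and \<open>2\<close>, the products \<open>p_fps * F\<close> through \<open>3\<close>; then
    \<open>F\<close> is cancelled, being a nonzero power series.\<close>
  have "(fps_X * fps_deriv p_fps + c * p_fps) * F = (p_fps ^ 2 + q * fps_X) * F"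
    using 1 2 3 by algebra
  then show ?thesis
    using phi_fps_inverse by (simp add: F_def c_def q_def)
qed

lemma p_fps_0: "fps_nth p_fps 0 = 0"
  by (simp add: p_fps_def)

text \<open>Coefficient \<open>k\<close> of \<open>riccati_fps\<close>. Since coefficient 0 of
  \<open>p_fps\<close> vanishes, the convolution reaches only indices strictly between 0 and
  \<open>k\<close>, and \<open>k + \<nu>\<close> is nonzero for \<open>k \<ge> 1\<close>; the
  coefficients are thus determined successively.\<close>

lemma p_fps_recursion:
  "(of_nat k + of_real \<nu>) * fps_nth p_fps k =
     (\<Sum>i=0..k. fps_nth p_fps i * fps_nth p_fps (k - i)) + (if k = 1 then 1 / 4 else 0)"
proof -
  have "fps_nth (fps_X * fps_deriv p_fps) k = of_nat k * fps_nth p_fps k"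
    by (cases k) auto
  then show ?thesis
    using arg_cong[OF riccati_fps, of "\<lambda>f. fps_nth f k"]
    by (simp add: power2_eq_square fps_mult_nth[of p_fps p_fps] algebra_simps del: fps_X_mult_nth)
qed

lemma p_fps_real: "fps_nth p_fps k = of_real (rayleigh k)"
proof (induction k rule: less_induct)
  case (less k)
  show ?case
  proof (cases "k = 0")
    case True
    then show ?thesis by (simp add: p_fps_0 rayleigh_def)
  next
    case False
    have "fps_nth p_fps i * fps_nth p_fps (k - i) \<in> \<real>" if "i \<in> {0..k}" for i
    proof (cases "i = 0 \<or> i = k")
      case True
      then show ?thesis by (auto simp: p_fps_0)
    next
      case False
      then show ?thesis
        using that less[of i] less[of "k - i"] by auto
    qed
    then have "(of_nat k + of_real \<nu>) * fps_nth p_fps k \<in> \<real>"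
      unfolding p_fps_recursion by (intro Reals_add sum_in_Reals) auto
    moreover have "real k + \<nu> \<noteq> 0"
      using order False by (cases k) auto
    ultimately have "(of_nat k + of_real \<nu>) * fps_nth p_fps k / of_real (real k + \<nu>) \<in> \<real>"
      by (intro Reals_divide) auto
    moreover have "of_nat k + of_real \<nu> = complex_of_real (real k + \<nu>)"
      by simp
    ultimately have "fps_nth p_fps k \<in> \<real>"
      using \<open>real k + \<nu> \<noteq> 0\<close> by (simp del: of_real_add)
    then show ?thesis
      by (simp add: rayleigh_def)
  qed
qed

section \<open>Positivity and growth of the Taylor coefficients of \<open>p\<close>\<close>

lemma rayleigh_recursion:
  "(real k + \<nu>) * rayleigh k = (\<Sum>i=0..k. rayleigh i * rayleigh (k - i)) + (if k = 1 then 1 / 4 else 0)"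
proof -
  have "complex_of_real ((real k + \<nu>) * rayleigh k) =
      of_real ((\<Sum>i=0..k. rayleigh i * rayleigh (k - i)) + (if k = 1 then 1 / 4 else 0))"
    using p_fps_recursion[of k] by (simp add: p_fps_real)
  then show ?thesis
    by (simp only: of_real_eq_iff)
qed

lemma rayleigh_0: "rayleigh 0 = 0"
  by (simp add: rayleigh_def p_fps_0)

lemma rayleigh_1: "rayleigh 1 = 1 / (4 * (1 + \<nu>))"
  using rayleigh_recursion[of 1] rayleigh_0 order by (simp add: field_simps)

lemma rayleigh_1_pos: "0 < rayleigh (Suc 0)"
  using order rayleigh_1 by simp

text \<open>With \<open>C\<close> in front, the \<open>k - 1\<close> products in the recursion contribute
  \<open>(k - 1) C^2 \<delta>^k \<ge> (k + \<nu>) C \<delta>^k\<close> as soon as \<open>C \<ge> 2 + \<nu>\<close>.\<close>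
lemma rayleigh_lower_bound:
  assumes "1 \<le> k"
  shows "(2 + \<nu>) * (rayleigh 1 / (2 + \<nu>)) ^ k \<le> rayleigh k"
  using assms
proof (induction k rule: less_induct)
  case (less k)
  define C where "C = 2 + \<nu>"
  define d where "d = rayleigh 1 / C"
  have C: "1 < C" and d: "0 < d"
    using order rayleigh_1_pos by (auto simp: C_def d_def)
  show ?case
  proof (cases "k = 1")
    case True
    then show ?thesis using order by simp
  next
    case False
    with less.prems have k: "2 \<le> k" by simp
    have "C * d ^ k * (real k + \<nu>) \<le> C * d ^ k * (C * real (k - 1))"
    proof (rule mult_left_mono)
      have "0 \<le> (1 + \<nu>) * (real k - 2)"
        using order k by simp
      then show "real k + \<nu> \<le> C * real (k - 1)"
        using k by (simp add: C_def algebra_simps of_nat_diff)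
    qed (use C d in auto)
    also have "\<dots> = (\<Sum>i=1..k-1. C * d ^ i * (C * d ^ (k - i)))"
    proof -
      have "C * d ^ i * (C * d ^ (k - i)) = C\<^sup>2 * d ^ k" if "i \<in> {1..k-1}" for i
      proof -
        have "i + (k - i) = k"
          using that by auto
        then have "d ^ k = d ^ i * d ^ (k - i)"
          by (metis power_add)
        then show ?thesis
          by (simp add: power2_eq_square)
      qed
      then have "(\<Sum>i=1..k-1. C * d ^ i * (C * d ^ (k - i))) = (\<Sum>i=1..k-1. C\<^sup>2 * d ^ k)"
        by (intro sum.cong refl)
      then show ?thesis
        by (simp add: power2_eq_square mult_ac)
    qed
    also have "\<dots> \<le> (\<Sum>i=1..k-1. rayleigh i * rayleigh (k - i))"
    proof (rule sum_mono)
      fix i assume i: "i \<in> {1..k-1}"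
      with k have "C * d ^ i \<le> rayleigh i" "C * d ^ (k - i) \<le> rayleigh (k - i)"
        using less.IH[of i] less.IH[of "k - i"] by (auto simp: C_def d_def)
      moreover have "0 \<le> C * d ^ i" "0 \<le> C * d ^ (k - i)"
        using C d by auto
      ultimately show "C * d ^ i * (C * d ^ (k - i)) \<le> rayleigh i * rayleigh (k - i)"
        by (intro mult_mono) auto
    qed
    also have "\<dots> \<le> (\<Sum>i=0..k. rayleigh i * rayleigh (k - i))"
    proof (rule eq_refl, rule sum.mono_neutral_left)
      show "\<forall>i\<in>{0..k} - {1..k-1}. rayleigh i * rayleigh (k - i) = 0"
      proof
        fix i assume "i \<in> {0..k} - {1..k-1}"
        then have "i = 0 \<or> i = k" by auto
        then show "rayleigh i * rayleigh (k - i) = 0" by (auto simp: rayleigh_0)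
      qed
    qed auto
    also have "\<dots> = (real k + \<nu>) * rayleigh k"
      using rayleigh_recursion[of k] k by simp
    finally have "C * d ^ k * (real k + \<nu>) \<le> rayleigh k * (real k + \<nu>)"
      by (simp add: mult_ac)
    then show ?thesis
      using order k by (simp add: C_def d_def)
  qed
qed

lemma rayleigh_pos: "1 \<le> k \<Longrightarrow> 0 < rayleigh k"
  using order by (intro less_le_trans[OF _ rayleigh_lower_bound]) (auto intro!: mult_pos_pos zero_less_power divide_pos_pos rayleigh_1_pos)

lemma rayleigh_nonneg: "0 \<le> rayleigh k"
  using rayleigh_pos[of k] rayleigh_0 by (cases "k = 0") auto

text \<open>At the point \<open>(2 + \<nu>) / rayleigh 1\<close> the lower bound keeps every term
  after the constant one at least \<open>2 + \<nu>\<close>, so the terms do not tend to 0.\<close>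

lemma conv_radius_p_finite: "fps_conv_radius p_fps \<le> ereal ((2 + \<nu>) / rayleigh 1)"
proof (rule ccontr)
  define z :: complex where "z = of_real ((2 + \<nu>) / rayleigh 1)"
  have pos: "0 < (2 + \<nu>) / rayleigh 1"
    using order unfolding rayleigh_1 by simp
  assume "\<not> ?thesis"
  then have "norm z < fps_conv_radius p_fps"
    using pos unfolding z_def norm_of_real by (simp only: abs_of_pos not_le)
  then have "(\<lambda>k. norm (fps_nth p_fps k * z ^ k)) \<longlonglongrightarrow> 0"
    by (intro summable_LIMSEQ_zero norm_summable_fps)
  moreover have "2 + \<nu> \<le> norm (fps_nth p_fps k * z ^ k)" if "1 \<le> k" for k
  proof -
    have "2 + \<nu> = (2 + \<nu>) * (rayleigh 1 / (2 + \<nu>)) ^ k * ((2 + \<nu>) / rayleigh 1) ^ k"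
      using order pos rayleigh_pos[of 1] by (simp add: power_divide)
    also have "\<dots> \<le> rayleigh k * ((2 + \<nu>) / rayleigh 1) ^ k"
      using pos that by (intro mult_right_mono rayleigh_lower_bound) auto
    also have "\<dots> = norm (fps_nth p_fps k * z ^ k)"
      using pos rayleigh_nonneg order unfolding z_def p_fps_real norm_mult norm_power norm_of_real by simp
    finally show ?thesis .
  qed
  ultimately have "2 + \<nu> \<le> 0"
    by (intro tendsto_lowerbound) (auto simp: eventually_sequentially intro!: exI[of _ 1])
  then show False using order by simp
qed

section \<open>The zeros of \<open>phi\<close> of least modulus\<close>

lemma phi_expansion: "phi has_fps_expansion phi_fps"
  and dphi_expansion: "dphi has_fps_expansion fps_deriv phi_fps"
  unfolding phi_def dphi_def by (auto intro!: eval_fps_has_fps_expansion)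

lemma inverse_phi_expansion: "(\<lambda>w. inverse (phi w)) has_fps_expansion inverse phi_fps"
  by (intro has_fps_expansion_inverse phi_expansion) (simp add: phi_fps_nth coef_0)

lemma p_expansion: "p has_fps_expansion p_fps"
proof -
  have "(\<lambda>w. - (w * dphi w * inverse (phi w))) has_fps_expansion p_fps"
    unfolding p_fps_def
    by (intro fps_expansion_intros inverse_phi_expansion dphi_expansion)
  then show ?thesis
    by (simp add: p_def[abs_def] divide_inverse)
qed

text \<open>Without zeros of \<open>phi\<close>, the function \<open>p\<close> would be entire and
  its Taylor series would converge everywhere, contrary to
  \<open>conv_radius_p_finite\<close>.\<close>

lemma phi_has_zero: "{w. phi w = 0} \<noteq> {}"
proof
  assume "{w. phi w = 0} = {}"
  then have "p holomorphic_on eball 0 \<infinity>"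
    unfolding p_def[abs_def] by (intro holomorphic_intros holomorphic_phi holomorphic_dphi) auto
  then have "fps_conv_radius p_fps \<ge> \<infinity>"
    by (rule holomorphic_on_imp_fps_conv_radius_ge[OF p_expansion])
  then show False using conv_radius_p_finite by auto
qed

text \<open>The least modulus of a zero. That \<open>R\<close> is itself a zero is proved in
  \<open>phi_R\<close>; it is then the square of the first positive zero of
  \<open>bessel_J \<nu>\<close>.\<close>

definition R :: real where
  "R = infdist 0 {w. phi w = 0}"

lemma phi_nonzero: "norm w < R \<Longrightarrow> phi w \<noteq> 0"
  unfolding R_def using infdist_le[of w "{w. phi w = 0}" 0] by force

lemma R_attained: obtains w where "phi w = 0" "norm w = R"
proof -
  have "closed {w. phi w = 0}"
    by (intro closed_Collect_eq continuous_intros)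
  then obtain w where "w \<in> {w. phi w = 0}" "infdist 0 {w. phi w = 0} = dist 0 w"
    using infdist_attains_inf[OF _ phi_has_zero] by blast
  then show ?thesis using that[of w] by (simp add: R_def)
qed

lemma R_pos: "0 < R"
  by (metis R_attained phi_0 zero_less_norm_iff zero_neq_one)

lemma phi_real: "phi (of_real r) = of_real (Re (phi (of_real r)))"
  and dphi_real: "dphi (of_real r) = of_real (Re (dphi (of_real r)))"
  using cnj_phi[of "of_real r"] cnj_dphi[of "of_real r"] by (simp_all add: complex_eq_iff)

text \<open>On the real axis \<open>phi\<close> is real, it equals 1 at the origin and has no zero
  of modulus below \<open>R\<close>; the intermediate value theorem excludes a sign change.\<close>

lemma phi_real_pos: "\<bar>r\<bar> < R \<Longrightarrow> 0 < Re (phi (of_real r))"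
proof (rule ccontr)
  define f where "f r = Re (phi (of_real r))" for r
  have cont: "continuous_on S f" for S
    unfolding f_def by (intro continuous_intros)
  assume "\<bar>r\<bar> < R" "\<not> 0 < Re (phi (of_real r))"
  then have "\<exists>x. \<bar>x\<bar> \<le> \<bar>r\<bar> \<and> f x = 0"
    using IVT2'[of f r 0 0] IVT'[of f r 0 0] cont
    by (cases "0 \<le> r") (force simp: f_def)+
  then obtain x where x: "\<bar>x\<bar> \<le> \<bar>r\<bar>" "f x = 0" by blast
  then have "phi (of_real x) = 0"
    using phi_real[of x] by (simp add: f_def)
  moreover have "norm (complex_of_real x) < R"
    using x \<open>\<bar>r\<bar> < R\<close> by simp
  ultimately show False using phi_nonzero by blast
qed

lemma holomorphic_p: "p holomorphic_on ball 0 R"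
  unfolding p_def[abs_def]
  by (intro holomorphic_intros holomorphic_phi holomorphic_dphi) (auto simp: phi_nonzero)

lemma conv_radius_p: "ereal R \<le> fps_conv_radius p_fps"
  using holomorphic_p by (intro holomorphic_on_imp_fps_conv_radius_ge[OF p_expansion]) simp

lemma eval_p_fps: "norm w < R \<Longrightarrow> eval_fps p_fps w = p w"
  by (rule has_fps_expansion_imp_eval_fps_eq[OF p_expansion _ holomorphic_p])

section \<open>Comparison with the values on the positive axis\<close>

lemma norm_p_le: "norm w < R \<Longrightarrow> norm (p w) \<le> Re (p (of_real (norm w)))"
proof -
  assume w: "norm w < R"
  then have "ereal (norm w) < fps_conv_radius p_fps"
    by (intro less_le_trans[OF _ conv_radius_p]) simp
  then show ?thesis
    using eval_fps_nonneg_coeffs(1)[OF p_fps_real rayleigh_nonneg, of w] w by (simp add: eval_p_fps)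
qed

lemma p_strict_mono: "0 \<le> r \<Longrightarrow> r < r' \<Longrightarrow> r' < R \<Longrightarrow> Re (p (of_real r)) < Re (p (of_real r'))"
proof -
  assume r: "0 \<le> r" "r < r'" "r' < R"
  then have "ereal r' < fps_conv_radius p_fps"
    by (intro less_le_trans[OF _ conv_radius_p]) simp
  then show ?thesis
    using eval_fps_nonneg_coeffs(2)[OF p_fps_real rayleigh_nonneg, of r r'] r rayleigh_1_pos
    by (simp add: eval_p_fps)
qed

text \<open>The reciprocal of \<open>phi\<close> also has nonnegative Taylor coefficients, because
  \<open>D (1 / phi) = p / phi\<close> is a recursion with the nonnegative weights
  \<open>rayleigh i\<close>. Its modulus at \<open>w\<close> is therefore at most its value at
  \<open>norm w\<close>.\<close>

lemma norm_phi_ge: 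
  assumes "norm w < R"
  shows "Re (phi (of_real (norm w))) \<le> norm (phi w)"
proof -
  define q where "q k = Re (fps_nth (inverse phi_fps) k)" for k
  have rec: "of_nat k * fps_nth (inverse phi_fps) k =
      (\<Sum>i=0..k. fps_nth p_fps i * fps_nth (inverse phi_fps) (k - i))" for k
  proof -
    have 1: "fps_deriv (inverse phi_fps) = - fps_deriv phi_fps * inverse phi_fps ^ 2"
      by (rule fps_inverse_deriv) (simp add: phi_fps_nth coef_0)
    have "fps_X * fps_deriv (inverse phi_fps) = p_fps * inverse phi_fps"
      unfolding 1 p_fps_def by (simp add: power2_eq_square mult_ac)
    moreover have "fps_nth (fps_X * fps_deriv (inverse phi_fps)) k = of_nat k * fps_nth (inverse phi_fps) k"
      by (cases k) auto
    ultimately show ?thesis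
      by (simp add: fps_mult_nth[of p_fps])
  qed
  have q: "fps_nth (inverse phi_fps) k = of_real (q k) \<and> 0 \<le> q k" for k
  proof (induction k rule: less_induct)
    case (less k)
    show ?case
    proof (cases "k = 0")
      case True
      then show ?thesis by (simp add: q_def phi_fps_nth coef_0)
    next
      case False
      have "fps_nth (inverse phi_fps) k =
          (\<Sum>i=0..k. fps_nth p_fps i * fps_nth (inverse phi_fps) (k - i)) / of_nat k"
        using rec[of k] False by (simp add: field_simps)
      also have "(\<Sum>i=0..k. fps_nth p_fps i * fps_nth (inverse phi_fps) (k - i)) =
          (\<Sum>i=0..k. of_real (rayleigh i * q (k - i)))"
      proof (rule sum.cong)
        fix i assume "i \<in> {0..k}"
        then show "fps_nth p_fps i * fps_nth (inverse phi_fps) (k - i) = of_real (rayleigh i * q (k - i))"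
          using less[of "k - i"] False by (cases "i = 0") (simp_all add: rayleigh_0 p_fps_real)
      qed simp
      finally have *: "fps_nth (inverse phi_fps) k = of_real ((\<Sum>i=0..k. rayleigh i * q (k - i)) / k)"
        by simp
      have "0 \<le> rayleigh i * q (k - i)" if "i \<in> {0..k}" for i
        using less[of "k - i"] that False rayleigh_nonneg[of i] by (cases "i = 0") (simp_all add: rayleigh_0)
      then have "0 \<le> (\<Sum>i=0..k. rayleigh i * q (k - i)) / k"
        by (intro divide_nonneg_nonneg sum_nonneg) auto
      moreover have "q k = (\<Sum>i=0..k. rayleigh i * q (k - i)) / k"
        unfolding q_def[of k] * by (rule Re_complex_of_real)
      ultimately show ?thesis
        using * by simp
    qed
  qed
  have holo: "(\<lambda>w. inverse (phi w)) holomorphic_on ball 0 R"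
    by (intro holomorphic_intros holomorphic_phi) (auto simp: phi_nonzero)
  have conv: "ereal R \<le> fps_conv_radius (inverse phi_fps)"
    using holo by (intro holomorphic_on_imp_fps_conv_radius_ge[OF inverse_phi_expansion]) simp
  have "ereal (norm w) < fps_conv_radius (inverse phi_fps)"
    using assms by (intro less_le_trans[OF _ conv]) simp
  then have "norm (inverse (phi w)) \<le> Re (inverse (phi (of_real (norm w))))"
    using eval_fps_nonneg_coeffs(1)[of "inverse phi_fps" q w] q assms
    by (simp add: has_fps_expansion_imp_eval_fps_eq[OF inverse_phi_expansion _ holo])
  moreover have "Re (inverse (phi (of_real (norm w)))) = inverse (Re (phi (of_real (norm w))))"
    by (subst phi_real) (simp flip: of_real_inverse)
  moreover have "0 < Re (phi (of_real (norm w)))" "0 < norm (phi w)"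
    using phi_real_pos[of "norm w"] phi_nonzero[OF assms] assms by auto
  ultimately show ?thesis
    by (simp add: norm_inverse)
qed

text \<open>By continuity the inequality of \<open>norm_phi_ge\<close> persists on the closed disc.
  At a zero \<open>w\<close> of modulus \<open>R\<close> it squeezes the value of \<open>phi\<close>
  at \<open>R\<close> between 0 and \<open>norm (phi w) = 0\<close>.\<close>

lemma phi_R: "phi (of_real R) = 0"
proof -
  obtain w where w: "phi w = 0" "norm w = R"
    by (rule R_attained)
  let ?S = "{w. Re (phi (of_real (norm w))) \<le> norm (phi w) \<and> 0 \<le> Re (phi (of_real (norm w)))}"
  have "ball 0 R \<subseteq> ?S"
    using norm_phi_ge phi_real_pos by (auto simp: less_imp_le)
  moreover have "closed ?S"
    by (intro closed_Collect_conj closed_Collect_le continuous_intros)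
  ultimately have "closure (ball 0 R) \<subseteq> ?S"
    by (rule closure_minimal)
  moreover have "w \<in> closure (ball 0 R)"
    using w R_pos by simp
  ultimately have "w \<in> ?S"
    by blast
  then have "Re (phi (of_real R)) = 0"
    using w by simp
  then show ?thesis
    by (subst phi_real) simp
qed

lemma cnj_p: "p (cnj w) = cnj (p w)"
  by (simp add: p_def cnj_phi cnj_dphi)

lemma p_real: "p (of_real r) = of_real (Re (p (of_real r)))"
  using cnj_p[of "of_real r"] by (simp add: complex_eq_iff)

lemma DERIV_phi_real:
  "((\<lambda>r. Re (phi (of_real r))) has_real_derivative Re (dphi (of_real r))) (at r within S)"
  using DERIV_phi[OF DERIV_ident]
  by (intro has_field_derivative_Re has_vector_derivative_real_field) simp

text \<open>Otherwise \<open>r^\<tau> \<phi>(r)\<close> would increase on \<open>(0, R)\<close> from a positive value to \<open>0\<close>.\<close>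
lemma p_attains:
  assumes "0 < \<tau>"
  obtains r where "0 < r" "r < R" "p (of_real r) = of_real \<tau>"
proof -
  define f where "f r = Re (phi (of_real r))" for r
  define f' where "f' r = Re (dphi (of_real r))" for r
  have f': "(f has_real_derivative f' r) (at r within S)" for r S
    unfolding f_def f'_def by (rule DERIV_phi_real)
  have cont: "continuous_on S f" "continuous_on S f'" for S
    unfolding f_def f'_def by (intro continuous_intros)+
  have fR: "f R = 0" and f_pos: "0 \<le> r \<Longrightarrow> r < R \<Longrightarrow> 0 < f r" for r
    using phi_R phi_real_pos[of r] by (simp_all add: f_def)
  \<comment> \<open>It suffices that this expression is nonpositive somewhere: at the origin it
    equals \<open>\<tau>\<close>, and at a positive zero of it \<open>p\<close> takes the value
    \<open>\<tau>\<close>.\<close>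
  have "\<exists>r. 0 < r \<and> r < R \<and> \<tau> * f r + r * f' r \<le> 0"
  proof (rule ccontr)
    assume "\<not> ?thesis"
    then have pos: "0 < \<tau> * f r + r * f' r" if "0 < r" "r < R" for r
      using that by (meson not_le)
    have "(R / 2) powr \<tau> * f (R / 2) < R powr \<tau> * f R"
    proof (rule DERIV_pos_imp_increasing_open[where f = "\<lambda>r. r powr \<tau> * f r"])
      fix x assume x: "R / 2 < x" "x < R"
      then have "0 < x" using R_pos by simp
      have "((\<lambda>r. r powr \<tau> * f r) has_real_derivative
          x powr (\<tau> - 1) * (\<tau> * f x + x * f' x)) (at x)"
        using \<open>0 < x\<close>
        by (auto intro!: derivative_eq_intros f' simp: powr_diff field_simps)
      moreover have "0 < x powr (\<tau> - 1) * (\<tau> * f x + x * f' x)"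
        using pos[of x] x \<open>0 < x\<close> by simp
      ultimately show "\<exists>y. ((\<lambda>r. r powr \<tau> * f r) has_real_derivative y) (at x) \<and> 0 < y"
        by blast
    qed (use R_pos in \<open>auto intro!: continuous_intros cont\<close>)
    then show False
      using fR f_pos[of "R / 2"] R_pos by (simp add: mult_less_0_iff)
  qed
  then obtain r1 where r1: "0 < r1" "r1 < R" "\<tau> * f r1 + r1 * f' r1 \<le> 0"
    by blast
  have "\<exists>r\<ge>0. r \<le> r1 \<and> \<tau> * f r + r * f' r = 0"
    using r1 f_pos[of 0] assms R_pos
    by (intro IVT2') (auto intro!: continuous_intros cont)
  then obtain r where r: "0 \<le> r" "r \<le> r1" "\<tau> * f r + r * f' r = 0"
    by blast
  moreover have "r \<noteq> 0"
    using r f_pos[of 0] assms R_pos by auto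
  moreover have "p (of_real r) = of_real \<tau>"
  proof -
    have "- (r * f' r / f r) = \<tau>"
      using f_pos[of r] r r1 by (simp add: field_simps)
    then have "of_real (- (r * f' r / f r)) = complex_of_real \<tau>"
      by (simp only:)
    moreover have "phi (of_real r) = of_real (f r)" "dphi (of_real r) = of_real (f' r)"
      using phi_real[of r] dphi_real[of r] by (simp_all add: f_def f'_def)
    ultimately show ?thesis
      by (simp add: p_def)
  qed
  ultimately show ?thesis
    using that[of r] r1 by simp
qed

section \<open>The half-plane containing the image of a disc when the order is negative\<close>

lemma p_0 [simp]: "p 0 = 0"
  by (simp add: p_def)

lemma DERIV_p:
  assumes "norm w < R"
  shows "(p has_field_derivative deriv p w) (at w)"
  using assms by (intro holomorphic_derivI[OF holomorphic_p]) auto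

lemma riccati:
  assumes "norm w < R"
  shows "w * deriv p w = (p w)\<^sup>2 - \<nu> * p w + w / 4"
proof -
  have nz: "phi w \<noteq> 0"
    using phi_nonzero[OF assms] .
  have "(p has_field_derivative
      - ((- (\<nu> * dphi w + phi w / 4) * phi w - w * dphi w * dphi w) / (phi w * phi w))) (at w)"
    unfolding p_def[abs_def]
    using nz by (auto intro!: derivative_eq_intros)
  then have "deriv p w = - ((- (\<nu> * dphi w + phi w / 4) * phi w - w * dphi w * dphi w) / (phi w * phi w))"
    by (rule DERIV_imp_deriv)
  then show ?thesis
    using nz by (simp add: p_def field_simps power2_eq_square)
qed

text \<open>Along the ray through \<open>w\<close>, the equation for \<open>\<phi>\<close> makes
  \<open>- t^\<nu> Im (D \<phi> cnj \<phi>)\<close> increase from its limit \<open>0\<close> at the origin.\<close>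
lemma Im_p_pos:
  assumes "norm w < R" "0 < Im w"
  shows "0 < Im (p w)"
proof -
  define N where "N t = - Im (of_real t * w * dphi (of_real t * w) * cnj (phi (of_real t * w)))" for t
  define M where "M t = - Im (w * dphi (of_real t * w) * cnj (phi (of_real t * w)))" for t
  \<comment> \<open>This is \<open>t powr \<nu> * N t\<close> with the factor \<open>t\<close> of
    \<open>N\<close> moved into the power: as \<open>\<nu> + 1 > 0\<close>, it is continuous at 0
    with value 0 even for negative \<nu>.\<close>
  define G where "G t = t powr (\<nu> + 1) * M t" for t
  have NM: "N t = t * M t" for t
    by (simp add: N_def M_def algebra_simps)
  have "G 0 < G 1"
  proof (rule DERIV_pos_imp_increasing_open[where f = G])
    fix t :: real assume t: "0 < t" "t < 1"
    define z where "z = of_real t * w"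
    have nz: "phi z \<noteq> 0"
    proof (rule phi_nonzero)
      have "norm z \<le> norm w"
        using t by (simp add: z_def norm_mult mult_left_le_one_le)
      then show "norm z < R" using assms by simp
    qed
    have 1: "((\<lambda>t. of_real t * w * dphi (of_real t * w)) has_vector_derivative
        - (\<nu> * dphi z + phi z / 4) * w) (at t)"
      unfolding z_def
      by (rule has_vector_derivative_real_field[of "\<lambda>x. x * w * dphi (x * w)"])
        (auto intro!: derivative_eq_intros)
    have 2: "((\<lambda>t. phi (of_real t * w)) has_vector_derivative dphi z * w) (at t)"
      unfolding z_def
      by (rule has_vector_derivative_real_field[of "\<lambda>x. phi (x * w)"])
        (auto intro!: derivative_eq_intros)
    have N': "(N has_real_derivative - Im (z * dphi z * cnj (dphi z * w) +
        - (\<nu> * dphi z + phi z / 4) * w * cnj (phi z))) (at t)"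
      unfolding N_def
      by (intro DERIV_minus has_field_derivative_Im)
        (use has_vector_derivative_mult[OF 1 has_vector_derivative_cnj[OF 2]] in \<open>simp add: z_def\<close>)
    have "((\<lambda>t. t powr \<nu> * N t) has_real_derivative
        t powr \<nu> * (Im w * (norm (phi z))\<^sup>2 / 4)) (at t)"
    proof (rule DERIV_cong)
      show "((\<lambda>t. t powr \<nu> * N t) has_real_derivative
          \<nu> * t powr (\<nu> - 1) * N t + - Im (z * dphi z * cnj (dphi z * w) +
        - (\<nu> * dphi z + phi z / 4) * w * cnj (phi z)) * t powr \<nu>) (at t)"
        using t by (intro DERIV_mult N') (auto intro!: derivative_eq_intros)
      \<comment> \<open>The factor \<open>t powr \<nu>\<close> is chosen so that the two terms with
        \<nu> cancel; the term with two factors \<open>dphi\<close> is real, and only the one with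
        \<open>Im w\<close> survives.\<close>
      have "t powr (\<nu> - 1) * N t = t powr \<nu> * M t"
        using t by (simp add: NM powr_diff)
      moreover have "Im (z * dphi z * cnj (dphi z * w)) = 0"
        by (simp add: z_def algebra_simps)
      moreover have "Im (\<nu> * dphi z * w * cnj (phi z)) = - \<nu> * M t"
        by (simp add: M_def z_def algebra_simps)
      moreover have "Im (phi z / 4 * w * cnj (phi z)) = Im w * (norm (phi z))\<^sup>2 / 4"
        unfolding cmod_power2 by (simp add: power2_eq_square algebra_simps)
      ultimately show "\<nu> * t powr (\<nu> - 1) * N t + - Im (z * dphi z * cnj (dphi z * w) +
        - (\<nu> * dphi z + phi z / 4) * w * cnj (phi z)) * t powr \<nu> =
        t powr \<nu> * (Im w * (norm (phi z))\<^sup>2 / 4)"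
        by (simp add: ring_distribs del: Im_divide_numeral times_complex.sel)
    qed
    then have "(G has_real_derivative t powr \<nu> * (Im w * (norm (phi z))\<^sup>2 / 4)) (at t)"
    proof (rule has_field_derivative_transform_within_open)
      show "t \<in> {0<..}" using t by simp
      show "x powr \<nu> * N x = G x" if "x \<in> {0<..}" for x
        using that by (simp add: G_def NM powr_add)
    qed simp
    then show "\<exists>y. (G has_real_derivative y) (at t) \<and> 0 < y"
      using t nz assms by (intro exI conjI) (assumption, simp)
  next
    show "continuous_on {0..1} G"
      unfolding G_def M_def using order by (intro continuous_intros continuous_on_powr') auto
  qed simp
  then have "0 < N 1"
    by (simp add: G_def NM)
  moreover have "phi w \<noteq> 0"
    using phi_nonzero assms by blast
  moreover have "Im (p w) = N 1 / (norm (phi w))\<^sup>2"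
    unfolding p_def N_def by (subst complex_div_cnj) (simp add: Im_divide_of_real diff_divide_distrib flip: of_real_power)
  ultimately show ?thesis
    by simp
qed

text \<open>On the upper half circle the Riccati equation gives \<open>Re p\<close> the angular
  derivative \<open>- (Im p * (2 * Re p - \<nu>) + Im z / 4)\<close>, which is negative because
  \<open>Re p \<ge> k \<ge> \<nu> / 2\<close>. Moving from any other \<open>w0\<close> to the
  negative axis would push \<open>Re p\<close> below its minimum.\<close>

lemma Re_p_min_on_circle:
  assumes r: "0 < r" "r < R" and k: "\<nu> \<le> 2 * k"
    and min: "\<And>w. norm w = r \<Longrightarrow> k \<le> Re (p w)"
    and w0: "norm w0 = r" "0 \<le> Im w0" "Re (p w0) = k"
  shows "w0 = - of_real r"
proof (rule ccontr)
  assume neq: "w0 \<noteq> - of_real r"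
  define u where "u \<theta> = Re (p (of_real r * cis \<theta>))" for \<theta>
  have w0_eq: "w0 = of_real r * cis (Arg w0)"
    using w0 by (metis rcis_cmod_Arg rcis_def)
  have arg: "0 \<le> Arg w0"
    using w0 by (simp add: Arg_less_0)
  have "Arg w0 < pi"
    using neq w0_eq Arg_le_pi[of w0] by (cases "Arg w0 = pi") auto
  have "u pi < u (Arg w0)"
  proof (rule DERIV_neg_imp_decreasing_open[where f = u, OF \<open>Arg w0 < pi\<close>])
    fix \<theta> assume "Arg w0 < \<theta>" "\<theta> < pi"
    define z where "z = of_real r * cis \<theta>"
    have nz: "norm z = r" and Imz: "0 < Im z"
      using r arg \<open>Arg w0 < \<theta>\<close> \<open>\<theta> < pi\<close> by (auto simp: z_def norm_mult sin_gt_zero)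
    have "((\<lambda>\<theta>. of_real r * cis \<theta>) has_vector_derivative \<i> * z) (at \<theta>)"
      unfolding cis_conv_exp z_def
      by (rule has_vector_derivative_real_field[of "\<lambda>x. of_real r * exp (\<i> * x)"])
        (auto intro!: derivative_eq_intros)
    from field_vector_diff_chain_at[OF this, of p "deriv p z"]
    have "((\<lambda>\<theta>. p (of_real r * cis \<theta>)) has_vector_derivative \<i> * (z * deriv p z)) (at \<theta>)"
      using DERIV_p[of z] nz r by (simp add: z_def o_def mult_ac)
    then have "(u has_real_derivative Re (\<i> * (z * deriv p z))) (at \<theta>)"
      unfolding u_def by (rule has_field_derivative_Re)
    moreover have "Re (\<i> * (z * deriv p z)) = - (Im (p z) * (2 * Re (p z) - \<nu>) + Im z / 4)"
      unfolding riccati[OF nz[THEN eq_refl, THEN le_less_trans, OF r(2)]]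
      by (simp add: power2_eq_square algebra_simps)
    moreover have "0 \<le> Im (p z) * (2 * Re (p z) - \<nu>)"
      using Im_p_pos[of z] Imz nz r min[of z] k by (intro mult_nonneg_nonneg) auto
    ultimately show "\<exists>y. (u has_real_derivative y) (at \<theta>) \<and> y < 0"
      using Imz by (intro exI[of _ "Re (\<i> * (z * deriv p z))"]) auto
  next
    show "continuous_on {Arg w0..pi} u"
      unfolding u_def
      by (intro continuous_intros continuous_on_compose2[OF holomorphic_on_imp_continuous_on[OF holomorphic_p]])
        (use r in \<open>auto simp: norm_mult\<close>)
  qed
  then have "Re (p (of_real r * cis pi)) < k"
    using w0 w0_eq by (simp add: u_def)
  then show False
    using min[of "of_real r * cis pi"] r by (simp add: norm_mult)
qed

text \<open>If \<open>Re p > - \<kappa>\<close> on the whole disc, Schwarz' lemma for \<open>p / (p + 2 \<kappa>)\<close> lets \<open>\<phi>(r)\<close> vanish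
  at \<open>R\<close> at most like \<open>(R - r)^(2 \<kappa>)\<close>, which is too slow for a differentiable function.\<close>
lemma Re_p_attains_le:
  assumes "0 < k" "k < 1 / 2"
  obtains w where "norm w < R" "Re (p w) \<le> - k"
proof (rule ccontr)
  assume "\<not> thesis"
  then have Re: "- k < Re (p w)" if "norm w < R" for w
    using that \<open>\<And>w. norm w < R \<Longrightarrow> Re (p w) \<le> - k \<Longrightarrow> thesis\<close> not_le by blast
  \<comment> \<open>The Moebius map \<open>q / (q + 2 * k)\<close> sends the half-plane
    \<open>Re q > - k\<close> into the unit disc and fixes 0; its pole is the reflection of 0 in the
    boundary line.\<close>
  define F where "F z = p (of_real R * z) / (p (of_real R * z) + of_real (2 * k))" for z
  have dom: "norm (of_real R * z) < R" if "norm z < 1" for z :: complex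
    using that R_pos by (simp add: norm_mult)
  have F_holo: "F holomorphic_on ball 0 1"
  proof -
    have "(p \<circ> (\<lambda>z. of_real R * z)) holomorphic_on ball 0 1"
      by (rule holomorphic_on_compose_gen[OF _ holomorphic_p])
        (use dom in \<open>auto intro!: holomorphic_intros\<close>)
    moreover have "p (of_real R * z) + of_real (2 * k) \<noteq> 0" if "norm z < 1" for z
      using Re[OF dom[OF that]] assms by (auto simp: complex_eq_iff)
    ultimately show ?thesis
      unfolding F_def o_def by (intro holomorphic_intros) auto
  qed
  have F_norm: "norm (F z) < 1" if "norm z < 1" for z
  proof -
    define q where "q = p (of_real R * z)"
    have "- k < Re q"
      using Re[OF dom[OF that]] by (simp add: q_def)
    then have "0 < k * (Re q + k)"
      using assms by simp
    then have "(norm q)\<^sup>2 < (norm (q + of_real (2 * k)))\<^sup>2"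
      unfolding cmod_power2 by (simp add: power2_eq_square algebra_simps)
    then have "norm q < norm (q + of_real (2 * k))"
      by (rule power_less_imp_less_base) simp
    then show ?thesis
      by (simp add: F_def q_def norm_divide divide_simps)
  qed
  have F_le: "norm (F z) \<le> norm z" if "norm z < 1" for z
    using Schwarz_Lemma(1)[OF F_holo, of z] F_norm that by (simp add: F_def)
  define f where "f r = Re (phi (of_real r))" for r
  define f' where "f' r = Re (dphi (of_real r))" for r
  have f': "(f has_real_derivative f' r) (at r within S)" for r S
    unfolding f_def f'_def by (rule DERIV_phi_real)
  have pf: "Re (p (of_real r)) = - (r * f' r / f r)" for r
  proof -
    have "phi (of_real r) = of_real (f r)" "dphi (of_real r) = of_real (f' r)"
      using phi_real[of r] dphi_real[of r] by (simp_all add: f_def f'_def)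
    then show ?thesis by (simp add: p_def flip: of_real_mult of_real_divide)
  qed
  have f_pos: "0 \<le> r \<Longrightarrow> r < R \<Longrightarrow> 0 < f r" for r
    using phi_real_pos[of r] by (simp add: f_def)
  \<comment> \<open>Schwarz' lemma at \<open>r / R\<close> bounds \<open>p\<close> at
    \<open>r\<close> by \<open>2 * k * r / (R - r)\<close>; inserting
    \<open>p = - r * f' / f\<close> turns this into a differential inequality for
    \<open>f\<close>.\<close>
  have ineq: "0 \<le> f' r * (R - r) + 2 * k * f r" if r: "0 < r" "r < R" for r
  proof -
    define q where "q = Re (p (of_real r))"
    have "0 \<le> q"
      using p_strict_mono[of 0 r] r by (simp add: q_def)
    have "F (of_real (r / R)) = of_real (q / (q + 2 * k))"
      using p_real[of r] R_pos by (simp add: F_def q_def)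
    then have "\<bar>q / (q + 2 * k)\<bar> \<le> r / R"
      using F_le[of "of_real (r / R)"] r by (simp only: norm_of_real) simp
    then have qR: "q * R \<le> r * (q + 2 * k)"
      using \<open>0 \<le> q\<close> assms R_pos by (simp add: field_simps)
    have "q * f r = - (r * f' r)"
      using f_pos[of r] r by (simp add: q_def pf)
    have "q * R * f r \<le> r * (q + 2 * k) * f r"
      using f_pos[of r] r qR by (intro mult_right_mono) auto
    then have "(q * f r) * R \<le> r * (q * f r) + r * (2 * k * f r)"
      by (simp add: algebra_simps)
    then have "0 \<le> r * (f' r * (R - r) + 2 * k * f r)"
      unfolding \<open>q * f r = - (r * f' r)\<close> by (simp add: algebra_simps)
    then show ?thesis
      using r by (simp add: zero_le_mult_iff)
  qed
  \<comment> \<open>By \<open>ineq\<close> the right side is nondecreasing in \<open>t\<close>, and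
    \<open>f 0 = 1\<close>.\<close>
  have lower: "R powr (- 2 * k) \<le> f t * (R - t) powr (- 2 * k)" if t: "0 < t" "t < R" for t
  proof -
    have "f 0 * (R - 0) powr (- 2 * k) \<le> f t * (R - t) powr (- 2 * k)"
    proof (rule DERIV_nonneg_imp_increasing_open[where f = "\<lambda>t. f t * (R - t) powr (- 2 * k)"])
      fix x assume x: "0 < x" "x < t"
      have "((\<lambda>t. f t * (R - t) powr (- 2 * k)) has_real_derivative
          (R - x) powr (- 2 * k - 1) * (f' x * (R - x) + 2 * k * f x)) (at x)"
        using x t by (auto intro!: derivative_eq_intros f' simp: powr_diff field_simps)
      moreover have "0 \<le> (R - x) powr (- 2 * k - 1) * (f' x * (R - x) + 2 * k * f x)"
        using ineq[of x] x t by simp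
      ultimately show "\<exists>y. ((\<lambda>t. f t * (R - t) powr (- 2 * k)) has_real_derivative y) (at x) \<and> 0 \<le> y"
        by blast
    qed (use t in \<open>auto intro!: continuous_intros simp: f_def\<close>)
    then show ?thesis by (simp add: f_def)
  qed
  have "bounded (f' ` {0..R})"
    unfolding f'_def by (intro compact_imp_bounded compact_continuous_image continuous_intros) auto
  then obtain B where B: "\<forall>x\<in>{0..R}. \<bar>f' x\<bar> \<le> B"
    unfolding bounded_iff by auto
  have upper: "f t \<le> B * (R - t)" if t: "0 < t" "t < R" for t
  proof -
    obtain z where z: "t < z" "z < R" "f R - f t = (R - t) * f' z"
      using MVT2[of t R f f'] t f' by auto
    have "f t = (R - t) * (- f' z)"
      using z phi_R by (simp add: f_def)
    also have "\<dots> \<le> (R - t) * B"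
      using bspec[OF B, of z] z t by (intro mult_left_mono) auto
    finally show ?thesis by (simp add: mult.commute)
  qed
  have ge: "R powr (- 2 * k) \<le> B * (R - t) powr (1 - 2 * k)" if t: "t \<in> {0<..<R}" for t
  proof -
    have "R powr (- 2 * k) \<le> B * (R - t) * (R - t) powr (- 2 * k)"
      using lower[of t] upper[of t] t by (meson greaterThanLessThan_iff mult_right_mono order_trans powr_ge_zero)
    also have "\<dots> = B * (R - t) powr (1 - 2 * k)"
      using t powr_add[of "R - t" 1 "- 2 * k"] by simp
    finally show ?thesis .
  qed
  \<comment> \<open>Let \<open>t\<close> tend to \<open>R\<close>: the exponent
    \<open>1 - 2 * k\<close> is positive, so the upper bound tends to 0 while the lower bound is a
    positive constant.\<close>
  have "continuous_on (closure {0<..<R}) (\<lambda>t. B * (R - t) powr (1 - 2 * k))"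
    using assms R_pos by (intro continuous_intros continuous_on_powr') auto
  moreover have "R \<in> closure {0<..<R}"
    using R_pos by simp
  ultimately have "R powr (- 2 * k) \<le> B * (R - R) powr (1 - 2 * k)"
    by (rule continuous_ge_on_closure[where f = "\<lambda>t. B * (R - t) powr (1 - 2 * k)"]) (rule ge)
  then show False
    using R_pos by simp
qed

text \<open>By \<open>Re_p_attains_le\<close> there are points with \<open>Re p \<le> - k\<close>;
  \<open>r\<close> is the least modulus of one. By continuity \<open>Re p \<ge> - k\<close> on that
  circle, and after a reflection in the real axis \<open>Re_p_min_on_circle\<close> identifies the
  point as \<open>- r\<close>.\<close>

lemma Re_p_gt_disc:
  assumes k: "0 < k" "k < 1 / 2" "2 * k \<le> - \<nu>"
  obtains r where "0 < r" "r < R" "p (- of_real r) = - of_real k"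
    "\<And>w. norm w < r \<Longrightarrow> - k < Re (p w)"
proof -
  obtain w1 where w1: "norm w1 < R" "Re (p w1) \<le> - k"
    using Re_p_attains_le[of k] k by blast
  define S where "S = {w \<in> cball 0 (norm w1). Re (p w) \<le> - k}"
  have cont: "continuous_on T p" if "T \<subseteq> ball 0 R" for T
    using holomorphic_on_imp_continuous_on[OF holomorphic_p] that continuous_on_subset by blast
  have "closed S"
    unfolding S_def
    by (intro continuous_on_closed_Collect_le continuous_intros cont) (use w1 in auto)
  then have "compact S"
    by (metis (no_types, lifting) S_def bounded_cball bounded_subset compact_eq_bounded_closed mem_Collect_eq subsetI)
  moreover have "w1 \<in> S"
    using w1 by (simp add: S_def)
  ultimately obtain w0 where w0: "w0 \<in> S" "\<And>w. w \<in> S \<Longrightarrow> norm w0 \<le> norm w"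
    using continuous_attains_inf[of S norm] by (auto intro: continuous_intros)
  define r where "r = norm w0"
  have r: "0 < r" "r < R"
    using w0(1) w1 k by (auto simp: r_def S_def)
  have gt: "- k < Re (p w)" if "norm w < r" for w
    using w0(2)[of w] w0(1) that by (force simp: S_def r_def)
  have ge: "- k \<le> Re (p w)" if "norm w = r" for w
  proof (rule continuous_ge_on_closure[of "ball 0 r" "\<lambda>w. Re (p w)"])
    show "continuous_on (closure (ball 0 r)) (\<lambda>w. Re (p w))"
      using r by (intro continuous_intros cont) auto
  qed (use that r gt in \<open>auto intro: less_imp_le\<close>)
  define w where "w = (if 0 \<le> Im w0 then w0 else cnj w0)"
  have "Re (p w) = - k"
    using ge[of w0] w0(1) by (auto simp: w_def S_def r_def cnj_p)
  moreover have "w = - of_real r"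
    by (rule Re_p_min_on_circle[of r "- k"])
      (use r ge k \<open>Re (p w) = - k\<close> in \<open>auto simp: w_def r_def\<close>)
  ultimately have "p (- of_real r) = - of_real k"
    using p_real[of "- r"] by simp
  then show ?thesis
    using that r gt by blast
qed

section \<open>Bessel functions of the first kind on the right half-plane\<close>

definition norm_const :: complex where
  "norm_const = 2 powr of_real \<nu> * Gamma (of_real \<nu> + 1)"

lemma norm_const_nonzero: "norm_const \<noteq> 0"
proof -
  have "0 < Gamma (\<nu> + 1)"
    using order by (intro Gamma_real_pos) auto
  then have "Gamma (of_real (\<nu> + 1)) \<noteq> (0 :: complex)"
    unfolding Gamma_complex_of_real by simp
  then show ?thesis
    by (simp add: norm_const_def)
qed

lemma bessel_J_eq: "z \<noteq> 0 \<Longrightarrow> bessel_J \<nu> z = z powr of_real \<nu> * phi (z\<^sup>2) / norm_const"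
proof -
  assume z: "z \<noteq> 0"
  have "norm_const * z powr (- of_real \<nu>) * bessel_J \<nu> z = phi (z\<^sup>2)"
    using z Lambda_eq_phi[of z] by (simp add: bessel_Lambda_def norm_const_def)
  moreover have "z powr of_real \<nu> * z powr (- of_real \<nu>) = 1"
    using z by (simp flip: powr_add)
  ultimately have "norm_const * bessel_J \<nu> z = z powr of_real \<nu> * phi (z\<^sup>2)"
    by (metis mult.assoc mult.left_commute mult_1)
  then show ?thesis
    using norm_const_nonzero by (simp add: field_simps)
qed

lemma alternating_power: "(-1) ^ n * a * (- y) ^ n = a * (y :: 'a :: comm_ring_1) ^ n"
proof -
  have "(-1) ^ n * (- y) ^ n = y ^ n"
    by (simp flip: power_mult_distrib)
  then show ?thesis
    by (simp add: mult_ac)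
qed

text \<open>The argument \<open>- (z^2)\<close> removes the alternating signs of \<open>phi\<close>.
  Working termwise avoids comparing the branches of the powers of \<open>z\<close> and
  \<open>\<i> * z\<close>.\<close>

lemma bessel_I_eq: "z \<noteq> 0 \<Longrightarrow> bessel_I \<nu> z = z powr of_real \<nu> * phi (- (z\<^sup>2)) / norm_const"
proof -
  assume z: "z \<noteq> 0"
  have Ln2: "Ln (z / 2) = Ln z - Ln 2"
    using z Ln_divide_of_real[of 2 z] Ln_of_real[of 2] by simp
  have d: "(z / 2) powr of_real \<nu> = z powr of_real \<nu> / 2 powr of_real \<nu>"
    using z by (simp add: powr_def Ln2 right_diff_distrib exp_diff)
  have G: "Gamma (of_real \<nu> + 1) \<noteq> (0 :: complex)"
    using norm_const_nonzero by (auto simp: norm_const_def)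
  have "1 / (fact n * Gamma (of_nat n + of_real \<nu> + 1)) * cpower (z / 2) (of_nat (2 * n) + of_real \<nu>) =
      (z powr of_real \<nu> / norm_const) * (fps_nth phi_fps n * (- (z\<^sup>2)) ^ n)" for n
  proof -
    have "cpower (z / 2) (of_nat (2 * n) + of_real \<nu>) = (z / 2) powr (of_nat (2 * n) + of_real \<nu>)"
      using z by (simp add: cpower_def)
    also have "\<dots> = (z / 2) powr of_nat (2 * n) * (z / 2) powr of_real \<nu>"
      by (rule powr_add)
    also have "(z / 2) powr of_nat (2 * n) = (z / 2) ^ (2 * n)"
      by (rule powr_nat') (use z in auto)
    also have "\<dots> = (z\<^sup>2) ^ n / 4 ^ n"
      by (simp add: power_mult power_divide)
    finally have "cpower (z / 2) (of_nat (2 * n) + of_real \<nu>) = (z\<^sup>2) ^ n / 4 ^ n * (z powr of_real \<nu> / 2 powr of_real \<nu>)"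
      by (simp only: d)
    moreover have "fps_nth phi_fps n * (- (z\<^sup>2)) ^ n = of_real (coef n) * (z\<^sup>2) ^ n"
      unfolding phi_fps_nth by (rule alternating_power)
    ultimately show ?thesis
      using G by (simp add: coef_Gamma norm_const_def mult_ac)
  qed
  then have "bessel_I \<nu> z = (\<Sum>n. (z powr of_real \<nu> / norm_const) * (fps_nth phi_fps n * (- (z\<^sup>2)) ^ n))"
    unfolding bessel_I_def by (simp only:)
  also have "\<dots> = (z powr of_real \<nu> / norm_const) * (\<Sum>n. fps_nth phi_fps n * (- (z\<^sup>2)) ^ n)"
    by (intro suminf_mult summable_fps) simp
  finally show ?thesis
    by (simp add: phi_def eval_fps_def)
qed

section \<open>Positive roots of the defining equations\<close>

text \<open>Serves \<open>bessel_J\<close> with \<open>\<sigma> = 1\<close> and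
  \<open>bessel_I\<close> with \<open>\<sigma> = - 1\<close>. On the positive axis the power of
  \<open>z\<close> is differentiable, and the nonzero factor
  \<open>z powr \<nu> / norm_const\<close> splits off the whole left side.\<close>

lemma pos_root_iff:
  fixes \<sigma> a :: real
  assumes B: "\<And>z. z \<noteq> 0 \<Longrightarrow> B z = z powr of_real \<nu> * phi (of_real \<sigma> * z\<^sup>2) / norm_const" and x: "0 < x"
  shows "pos_root (\<lambda>z. z * deriv B z + of_real a * B z) x \<longleftrightarrow>
    of_real (\<nu> + a) * phi (of_real (\<sigma> * x\<^sup>2)) + 2 * (of_real (\<sigma> * x\<^sup>2) * dphi (of_real (\<sigma> * x\<^sup>2))) = 0"
proof -
  define z :: complex where "z = of_real x"
  have z: "z \<noteq> 0" "z \<notin> \<real>\<^sub>\<le>\<^sub>0"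
    using x by (simp_all add: z_def)
  have "((\<lambda>z. z powr of_real \<nu> * phi (of_real \<sigma> * z\<^sup>2) / norm_const) has_field_derivative
      (of_real \<nu> * z powr (of_real \<nu> - 1) * phi (of_real \<sigma> * z\<^sup>2) +
        z powr of_real \<nu> * (dphi (of_real \<sigma> * z\<^sup>2) * (of_real \<sigma> * (2 * z)))) / norm_const) (at z)"
    using z norm_const_nonzero by (auto intro!: derivative_eq_intros)
  then have "(B has_field_derivative
      (of_real \<nu> * z powr (of_real \<nu> - 1) * phi (of_real \<sigma> * z\<^sup>2) +
        z powr of_real \<nu> * (dphi (of_real \<sigma> * z\<^sup>2) * (of_real \<sigma> * (2 * z)))) / norm_const) (at z)"
    by (rule has_field_derivative_transform_within_open[of _ _ _ "- {0}"]) (use z B in auto)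
  then have "z * deriv B z = z powr of_real \<nu> / norm_const * (of_real \<nu> * phi (of_real \<sigma> * z\<^sup>2) +
      2 * (of_real \<sigma> * z\<^sup>2 * dphi (of_real \<sigma> * z\<^sup>2)))"
    using z norm_const_nonzero by (simp add: DERIV_imp_deriv powr_diff field_simps power2_eq_square)
  then have "z * deriv B z + of_real a * B z = z powr of_real \<nu> / norm_const *
      (of_real (\<nu> + a) * phi (of_real \<sigma> * z\<^sup>2) + 2 * (of_real \<sigma> * z\<^sup>2 * dphi (of_real \<sigma> * z\<^sup>2)))"
    using z by (simp add: B algebra_simps)
  then show ?thesis
    using x z norm_const_nonzero by (simp add: pos_root_def z_def)
qed

text \<open>For \<open>x^2 < R\<close> the equation says \<open>p (x^2) = \<tau>\<close>, and
  \<open>p\<close> is strictly increasing on \<open>[0, R)\<close>, so no root precedes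
  \<open>sqrt r\<close>.\<close>

lemma J_smallest_root:
  assumes "0 < r" "r < R" "p (of_real r) = of_real \<tau>" "\<nu> + a = 2 * \<tau>"
  shows "smallest_pos_root (\<lambda>z. z * deriv (bessel_J \<nu>) z + of_real a * bessel_J \<nu> z) (sqrt r)"
proof -
  have iff: "pos_root (\<lambda>z. z * deriv (bessel_J \<nu>) z + of_real a * bessel_J \<nu> z) x \<longleftrightarrow>
      p (of_real (x\<^sup>2)) = of_real \<tau>" if "0 < x" "x\<^sup>2 < R" for x
  proof -
    have "phi (of_real (x\<^sup>2)) \<noteq> 0"
      using that by (intro phi_nonzero) (simp only: norm_of_real abs_power2)
    moreover have p_eq_iff: "- (a / b) = t \<longleftrightarrow> 2 * t * b + 2 * a = 0" if "b \<noteq> 0" for a b t :: complex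
    proof -
      have "2 * t * b + 2 * a = 2 * b * (t - - (a / b))"
        using that by (simp add: algebra_simps)
      then have "2 * t * b + 2 * a = 0 \<longleftrightarrow> t = - (a / b)"
        using that by (simp del: diff_minus_eq_add)
      then show ?thesis
        by auto
    qed
    ultimately have "p (of_real (x\<^sup>2)) = of_real \<tau> \<longleftrightarrow>
        of_real (2 * \<tau>) * phi (of_real (x\<^sup>2)) + 2 * (of_real (x\<^sup>2) * dphi (of_real (x\<^sup>2))) = 0"
      unfolding p_def by simp
    then show ?thesis
      using that assms(4) pos_root_iff[of "bessel_J \<nu>" 1 x a] bessel_J_eq by simp
  qed
  have "pos_root (\<lambda>z. z * deriv (bessel_J \<nu>) z + of_real a * bessel_J \<nu> z) (sqrt r)"
    using iff[of "sqrt r"] assms by simp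
  moreover have "sqrt r \<le> y"
    if y: "pos_root (\<lambda>z. z * deriv (bessel_J \<nu>) z + of_real a * bessel_J \<nu> z) y" for y
  proof (rule ccontr)
    assume "\<not> sqrt r \<le> y"
    moreover have "0 < y"
      using y by (simp add: pos_root_def)
    ultimately have "y\<^sup>2 < r"
      by (metis not_le real_le_lsqrt less_imp_le)
    then have "p (of_real (y\<^sup>2)) = of_real \<tau>"
      using iff[of y] y \<open>0 < y\<close> assms by simp
    then show False
      using p_strict_mono[of "y\<^sup>2" r] \<open>y\<^sup>2 < r\<close> assms by simp
  qed
  ultimately show ?thesis
    by (simp add: smallest_pos_root_def)
qed

text \<open>For positive \<open>x\<close>, \<open>bessel_J \<nu> x\<close> vanishes exactly when
  \<open>phi\<close> vanishes at \<open>x^2\<close>; \<open>R\<close> is such a zero and none is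
  nearer to the origin.\<close>

lemma bessel_zero1_eq: "bessel_zero1 \<nu> = sqrt R"
proof -
  have iff: "pos_root (bessel_J \<nu>) x \<longleftrightarrow> 0 < x \<and> phi (of_real (x\<^sup>2)) = 0" for x
    using norm_const_nonzero by (auto simp: pos_root_def bessel_J_eq)
  have *: "smallest_pos_root (bessel_J \<nu>) (sqrt R)"
  proof -
    have "pos_root (bessel_J \<nu>) (sqrt R)"
      using iff R_pos phi_R by (simp flip: of_real_power)
    moreover have "sqrt R \<le> y" if "pos_root (bessel_J \<nu>) y" for y
    proof -
      have "\<not> norm (complex_of_real (y\<^sup>2)) < R" "0 < y"
        using that iff phi_nonzero by blast+
      then show ?thesis
        by (intro real_le_lsqrt) (simp_all only: norm_of_real abs_power2 not_less less_imp_le)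
    qed
    ultimately show ?thesis
      by (simp add: smallest_pos_root_def)
  qed
  moreover have "x = sqrt R" if "smallest_pos_root (bessel_J \<nu>) x" for x
    using that * unfolding smallest_pos_root_def by (meson antisym)
  ultimately show ?thesis
    unfolding bessel_zero1_def by (rule the_equality)
qed

text \<open>Up to a nonzero factor the left side of the equation at \<open>x\<close> is
  \<open>E (x^2)\<close>, and Bessel's equation gives \<open>E\<close> the derivative
  \<open>2 * (k + \<nu>) * f' + f / 2\<close>. At negative arguments the series of
  \<open>phi\<close> and \<open>dphi\<close> have terms of constant sign, so
  \<open>f > 0 > f'\<close>; with \<open>k + \<nu> < 0\<close> this makes \<open>E\<close> strictly
  increasing.\<close>

lemma I_unique_root:
  assumes r: "0 < r" and root: "p (- of_real r) = - of_real k" and k: "0 < k" "k + \<nu> < 0"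
    and a: "\<nu> + a = - 2 * k"
  shows "unique_pos_root (\<lambda>z. z * deriv (bessel_I \<nu>) z + of_real a * bessel_I \<nu> z) (sqrt r)"
proof -
  define f where "f x = Re (phi (- of_real x))" for x
  define f' where "f' x = Re (dphi (- of_real x))" for x
  define E where "E x = - 2 * k * f x - 2 * (x * f' x)" for x
  have f: "phi (- of_real x) = of_real (f x)" "dphi (- of_real x) = of_real (f' x)" for x
    using phi_real[of "- x"] dphi_real[of "- x"] by (simp_all add: f_def f'_def)
  have f_pos: "0 < f x" if "0 < x" for x
  proof -
    have "(\<lambda>n. of_real (coef n * x ^ n)) sums phi (- of_real x)"
      using sums_eval_fps[of "- of_real x" phi_fps]
      by (simp add: phi_def phi_fps_nth alternating_power)
    then have *: "(\<lambda>n. coef n * x ^ n) sums f x"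
      unfolding f sums_of_real_iff .
    have "0 < (\<Sum>n. coef n * x ^ n)"
      using that coef_pos by (intro suminf_pos sums_summable[OF *]) simp
    then show ?thesis
      using sums_unique[OF *] by simp
  qed
  have f'_neg: "f' x < 0" if "0 < x" for x
  proof -
    have "(\<lambda>n. of_real (- ((real n + 1) * coef (Suc n) * x ^ n))) sums dphi (- of_real x)"
    proof -
      have "fps_nth (fps_deriv phi_fps) n * (- of_real x) ^ n =
          of_real (- ((real n + 1) * coef (Suc n) * x ^ n))" for n
        using alternating_power[of n "- (of_nat n + 1) * of_real (coef (Suc n))" "complex_of_real x"]
        by (simp add: phi_fps_nth algebra_simps)
      then show ?thesis
        using sums_eval_fps[of "- of_real x" "fps_deriv phi_fps"] by (simp add: dphi_def)
    qed
    then have "(\<lambda>n. - ((real n + 1) * coef (Suc n) * x ^ n)) sums f' x"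
      unfolding f sums_of_real_iff .
    from sums_minus[OF this] have *: "(\<lambda>n. (real n + 1) * coef (Suc n) * x ^ n) sums (- f' x)"
      by simp
    have "0 < (\<Sum>n. (real n + 1) * coef (Suc n) * x ^ n)"
      using that coef_pos by (intro suminf_pos sums_summable[OF *]) (simp add: add_nonneg_pos)
    then show ?thesis
      using sums_unique[OF *] by simp
  qed
  have E': "(E has_real_derivative 2 * (k + \<nu>) * f' x + f x / 2) (at x)" for x
  proof -
    have "((\<lambda>z. of_real (- 2 * k) * phi (- z) + 2 * (- z * dphi (- z))) has_field_derivative
        of_real (- 2 * k) * (dphi (- z) * - 1) + 2 * (- (\<nu> * dphi (- z) + phi (- z) / 4) * - 1)) (at z)" for z
      by (intro DERIV_add DERIV_cmult DERIV_phi DERIV_Dphi DERIV_minus DERIV_ident)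
    from has_vector_derivative_real_field[OF this, of x]
    have "((\<lambda>x. of_real (- 2 * k) * phi (- of_real x) + 2 * (- of_real x * dphi (- of_real x)))
        has_vector_derivative 2 * (k + \<nu>) * dphi (- of_real x) + phi (- of_real x) / 2) (at x)"
      by (simp add: algebra_simps)
    then show ?thesis
      unfolding has_vector_derivative_complex_iff f E_def by simp
  qed
  have mono: "E x < E y" if "0 < x" "x < y" for x y
  proof (rule DERIV_pos_imp_increasing[OF \<open>x < y\<close>])
    fix t assume "x \<le> t" "t \<le> y"
    then have "0 < 2 * (k + \<nu>) * f' t + f t / 2"
      using that f_pos[of t] f'_neg[of t] k by (intro add_pos_pos mult_neg_neg) auto
    then show "\<exists>d. (E has_real_derivative d) (at t) \<and> 0 < d"
      using E' by blast
  qed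
  have iff: "pos_root (\<lambda>z. z * deriv (bessel_I \<nu>) z + of_real a * bessel_I \<nu> z) x \<longleftrightarrow> E (x\<^sup>2) = 0"
    if "0 < x" for x
  proof -
    have "of_real (\<nu> + a) * phi (- of_real (x\<^sup>2)) + 2 * (- of_real (x\<^sup>2) * dphi (- of_real (x\<^sup>2))) =
        complex_of_real (E (x\<^sup>2))"
      unfolding f E_def a by simp
    then show ?thesis
      using that pos_root_iff[of "bessel_I \<nu>" "- 1" x a] bessel_I_eq by (simp del: of_real_add)
  qed
  have "E r = 0"
  proof -
    have "of_real (r * f' r / f r) = complex_of_real (- k)"
      using root unfolding p_def f by simp
    then have "r * f' r / f r = - k"
      by (simp only: of_real_eq_iff)
    then show ?thesis
      using f_pos[OF r] by (simp add: E_def field_simps)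
  qed
  show ?thesis
    unfolding unique_pos_root_def
  proof (intro conjI allI impI)
    show "pos_root (\<lambda>z. z * deriv (bessel_I \<nu>) z + of_real a * bessel_I \<nu> z) (sqrt r)"
      using iff[of "sqrt r"] \<open>E r = 0\<close> r by simp
    fix y assume y: "pos_root (\<lambda>z. z * deriv (bessel_I \<nu>) z + of_real a * bessel_I \<nu> z) y"
    then have "0 < y" by (simp add: pos_root_def)
    then have "E (y\<^sup>2) = 0" using iff y by blast
    then have "y\<^sup>2 = r"
      using mono[of r "y\<^sup>2"] mono[of "y\<^sup>2" r] \<open>E r = 0\<close> r \<open>0 < y\<close> by (cases "y\<^sup>2" r rule: linorder_cases) auto
    then show "y = sqrt r"
      using \<open>0 < y\<close> by (simp add: real_sqrt_unique)
  qed
qed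

section \<open>Logarithmic derivatives of the normalized functions\<close>

lemma Re_p_less:
  assumes "norm w < r" "r < R"
  shows "Re (p w) < Re (p (of_real r))"
  using complex_Re_le_cmod[of "p w"] norm_p_le[of w] p_strict_mono[of "norm w" r] assms
  by simp

lemma norm_square_less: "norm (z :: complex) < sqrt r \<Longrightarrow> norm (z\<^sup>2) < r"
  by (metis norm_ge_zero norm_power real_less_rsqrt real_sqrt_abs real_sqrt_less_iff abs_of_nonneg)

lemma holomorphic_phi_square: "(\<lambda>z. phi (z\<^sup>2)) holomorphic_on S"
  by (rule holomorphic_on_compose[OF _ holomorphic_phi, unfolded o_def]) (intro holomorphic_intros)

lemma bessel_g_log_deriv:
  assumes "z \<noteq> 0" "norm (z\<^sup>2) < R"
  shows "bessel_g \<nu> z \<noteq> 0" "z * deriv (bessel_g \<nu>) z / bessel_g \<nu> z = 1 - 2 * p (z\<^sup>2)"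
proof -
  have eq: "bessel_g \<nu> = (\<lambda>z. z * phi (z\<^sup>2))"
    by (simp add: bessel_g_def Lambda_eq_phi fun_eq_iff)
  have nz: "phi (z\<^sup>2) \<noteq> 0"
    using assms phi_nonzero by blast
  show "bessel_g \<nu> z \<noteq> 0"
    using assms nz by (simp add: eq)
  have "(bessel_g \<nu> has_field_derivative phi (z\<^sup>2) + z * (dphi (z\<^sup>2) * (2 * z))) (at z)"
    unfolding eq by (auto intro!: derivative_eq_intros)
  then show "z * deriv (bessel_g \<nu>) z / bessel_g \<nu> z = 1 - 2 * p (z\<^sup>2)"
    using assms nz by (simp add: DERIV_imp_deriv eq p_def field_simps power2_eq_square)
qed

lemma bessel_h_log_deriv:
  assumes "z \<noteq> 0" "norm z < R"
  shows "bessel_h \<nu> z \<noteq> 0" "z * deriv (bessel_h \<nu>) z / bessel_h \<nu> z = 1 - p z"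
proof -
  have eq: "bessel_h \<nu> = (\<lambda>z. z * phi z)"
    by (simp add: bessel_h_def Lambda_eq_phi fun_eq_iff)
  have nz: "phi z \<noteq> 0"
    using assms phi_nonzero by blast
  show "bessel_h \<nu> z \<noteq> 0"
    using assms nz by (simp add: eq)
  have "(bessel_h \<nu> has_field_derivative phi z + z * dphi z) (at z)"
    unfolding eq by (auto intro!: derivative_eq_intros)
  then show "z * deriv (bessel_h \<nu>) z / bessel_h \<nu> z = 1 - p z"
    using assms nz by (simp add: DERIV_imp_deriv eq p_def field_simps power2_eq_square)
qed

text \<open>The choice in the definition is not vacuous: \<open>phi (z^2)\<close> has no zero in the
  disc, hence a holomorphic logarithm \<open>L\<close>, and subtracting \<open>L 0\<close> keeps the
  exponential because \<open>exp (L 0) = phi 0 = 1\<close>.\<close>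

lemma log_bessel_Lambda:
  "log_bessel_Lambda \<nu> holomorphic_on ball 0 (sqrt R)"
  "norm z < sqrt R \<Longrightarrow> exp (log_bessel_Lambda \<nu> z) = phi (z\<^sup>2)"
proof -
  have "\<exists>L. L holomorphic_on ball 0 (sqrt R) \<and> L 0 = 0 \<and>
      (\<forall>z\<in>ball 0 (sqrt R). exp (L z) = bessel_Lambda \<nu> z)"
  proof -
    have "(\<lambda>z. phi (z\<^sup>2)) holomorphic_on ball 0 (sqrt R)"
      by (rule holomorphic_phi_square)
    then obtain L where L: "L holomorphic_on ball 0 (sqrt R)"
        "\<And>z. z \<in> ball 0 (sqrt R) \<Longrightarrow> exp (L z) = phi (z\<^sup>2)"
      by (rule holomorphic_logarithm_exists[OF convex_ball open_ball, of _ 0 "sqrt R" 0])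
        (use phi_nonzero norm_square_less R_pos in auto)
    have "exp (L 0) = 1"
      using L(2)[of 0] R_pos by simp
    then have "exp (L z - L 0) = bessel_Lambda \<nu> z" if "z \<in> ball 0 (sqrt R)" for z
      using L(2)[OF that] by (simp add: exp_diff Lambda_eq_phi)
    then show ?thesis
      using L(1) by (intro exI[of _ "\<lambda>z. L z - L 0"]) (auto intro!: holomorphic_intros)
  qed
  from someI_ex[OF this]
  show "log_bessel_Lambda \<nu> holomorphic_on ball 0 (sqrt R)"
    "norm z < sqrt R \<Longrightarrow> exp (log_bessel_Lambda \<nu> z) = phi (z\<^sup>2)"
    unfolding log_bessel_Lambda_def bessel_zero1_eq by (auto simp: Lambda_eq_phi)
qed

lemma bessel_f_log_deriv:
  assumes "z \<noteq> 0" "norm z < sqrt R"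
  shows "bessel_f \<nu> z \<noteq> 0" "z * deriv (bessel_f \<nu>) z / bessel_f \<nu> z = 1 - 2 / of_real \<nu> * p (z\<^sup>2)"
proof -
  define L where "L = log_bessel_Lambda \<nu>"
  have z: "z \<in> ball 0 (sqrt R)"
    using assms by simp
  have expL: "exp (L w) = phi (w\<^sup>2)" if "w \<in> ball 0 (sqrt R)" for w
    using log_bessel_Lambda(2) that by (simp add: L_def)
  show "bessel_f \<nu> z \<noteq> 0"
    using assms by (simp add: bessel_f_def bessel_zero1_eq)
  have L': "(L has_field_derivative deriv L z) (at z)"
    using log_bessel_Lambda(1) z unfolding L_def by (intro holomorphic_derivI) auto
  \<comment> \<open>Differentiating \<open>exp (L w) = phi (w^2)\<close> in two ways determines
    \<open>deriv L z\<close> without an explicit branch.\<close>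
  have "((\<lambda>w. exp (L w)) has_field_derivative exp (L z) * deriv L z) (at z)"
    using L' by (auto intro!: derivative_eq_intros)
  then have "((\<lambda>w. phi (w\<^sup>2)) has_field_derivative exp (L z) * deriv L z) (at z)"
    by (rule has_field_derivative_transform_within_open[OF _ open_ball z]) (use expL in auto)
  moreover have "((\<lambda>w. phi (w\<^sup>2)) has_field_derivative dphi (z\<^sup>2) * (2 * z)) (at z)"
    by (auto intro!: derivative_eq_intros)
  ultimately have "phi (z\<^sup>2) * deriv L z = dphi (z\<^sup>2) * (2 * z)"
    unfolding expL[OF z] by (rule DERIV_unique)
  moreover have "phi (z\<^sup>2) \<noteq> 0"
    using expL[OF z] by (metis exp_not_eq_zero)
  ultimately have zL': "z * deriv L z = - 2 * p (z\<^sup>2)"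
    by (simp add: p_def field_simps power2_eq_square)
  define c where "c = 1 / complex_of_real \<nu>"
  have "((\<lambda>w. w * exp (c * L w)) has_field_derivative
      exp (c * L z) * (1 + c * (z * deriv L z))) (at z)"
    by (auto intro!: derivative_eq_intros L' simp: algebra_simps)
  then have "(bessel_f \<nu> has_field_derivative
      exp (c * L z) * (1 + c * (z * deriv L z))) (at z)"
    by (rule has_field_derivative_transform_within_open[OF _ open_ball z])
      (simp add: bessel_f_def bessel_zero1_eq L_def c_def)
  then have "deriv (bessel_f \<nu>) z = exp (c * L z) * (1 + c * (z * deriv L z))"
    by (rule DERIV_imp_deriv)
  moreover have "bessel_f \<nu> z = z * exp (c * L z)"
    using assms by (simp add: bessel_f_def bessel_zero1_eq L_def c_def)
  ultimately show "z * deriv (bessel_f \<nu>) z / bessel_f \<nu> z = 1 - 2 / of_real \<nu> * p (z\<^sup>2)"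
    using assms by (simp add: zL' c_def)
qed

lemma holomorphic_bessel_f: "bessel_f \<nu> holomorphic_on ball 0 (sqrt R)"
proof -
  have "(\<lambda>z. z * exp (1 / of_real \<nu> * log_bessel_Lambda \<nu> z)) holomorphic_on ball 0 (sqrt R)"
    by (intro holomorphic_intros log_bessel_Lambda)
  then show ?thesis
    by (rule holomorphic_transform) (simp add: bessel_f_def bessel_zero1_eq)
qed

section \<open>The radii of starlikeness\<close>

lemma radius_g:
  assumes "\<beta> < 1"
  shows "\<exists>y. smallest_pos_root (\<lambda>z. z * deriv (bessel_J \<nu>) z + of_real (1 - \<beta> - \<nu>) * bessel_J \<nu> z) y \<and>
    starlike_radius \<beta> (bessel_g \<nu>) = ereal y"
proof -
  \<comment> \<open>The condition \<open>1 - 2 * Re p > \<beta>\<close> means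
    \<open>Re p < \<tau>\<close>; equality occurs at the positive point
    \<open>sqrt r\<close>.\<close>
  define \<tau> where "\<tau> = (1 - \<beta>) / 2"
  obtain r where r: "0 < r" "r < R" "p (of_real r) = of_real \<tau>"
    using p_attains[of \<tau>] assms by (auto simp: \<tau>_def)
  have "starlike_radius \<beta> (bessel_g \<nu>) = ereal (sqrt r)"
  proof (rule starlike_radius_eqI)
    show "bessel_g \<nu> holomorphic_on ball 0 (sqrt r)"
      unfolding bessel_g_def[abs_def] Lambda_eq_phi
      by (intro holomorphic_intros holomorphic_phi_square)
    show "bessel_g \<nu> z \<noteq> 0 \<and> \<beta> < Re (z * deriv (bessel_g \<nu>) z / bessel_g \<nu> z)"
      if z: "norm z < sqrt r" "z \<noteq> 0" for z
    proof -
      have *: "norm (z\<^sup>2) < r" "norm (z\<^sup>2) < R"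
        using norm_square_less[OF z(1)] r by auto
      have "Re (p (z\<^sup>2)) < \<tau>"
        using Re_p_less[OF *(1) r(2)] r(3) by simp
      then show ?thesis
        unfolding bessel_g_log_deriv(2)[OF z(2) *(2)]
        using bessel_g_log_deriv(1)[OF z(2) *(2)] by (simp add: \<tau>_def)
    qed
    have "norm ((of_real (sqrt r))\<^sup>2 :: complex) < R"
      using r by (simp add: norm_power)
    then show "Re (of_real (sqrt r) * deriv (bessel_g \<nu>) (of_real (sqrt r)) / bessel_g \<nu> (of_real (sqrt r))) \<le> \<beta>"
      using bessel_g_log_deriv(2)[of "of_real (sqrt r)"] r
      by (simp add: \<tau>_def field_simps flip: of_real_power)
  qed (use r assms in auto)
  moreover have "smallest_pos_root (\<lambda>z. z * deriv (bessel_J \<nu>) z + of_real (1 - \<beta> - \<nu>) * bessel_J \<nu> z) (sqrt r)"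
    by (rule J_smallest_root[OF r]) (simp add: \<tau>_def)
  ultimately show ?thesis by blast
qed

lemma radius_h:
  assumes "\<beta> < 1"
  shows "\<exists>y. smallest_pos_root (\<lambda>z. z * deriv (bessel_J \<nu>) z + of_real (2 - 2 * \<beta> - \<nu>) * bessel_J \<nu> z) y \<and>
    starlike_radius \<beta> (bessel_h \<nu>) = ereal (y\<^sup>2)"
proof -
  \<comment> \<open>The logarithmic derivative of \<open>bessel_h\<close> is \<open>1 - p z\<close>
    at \<open>z\<close> itself, so the radius is \<open>r\<close>, whereas the root in the argument
    of \<open>bessel_J\<close> is \<open>sqrt r\<close>.\<close>
  obtain r where r: "0 < r" "r < R" "p (of_real r) = of_real (1 - \<beta>)"
    using p_attains[of "1 - \<beta>"] assms by auto
  have "starlike_radius \<beta> (bessel_h \<nu>) = ereal r"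
  proof (rule starlike_radius_eqI)
    show "bessel_h \<nu> holomorphic_on ball 0 r"
      unfolding bessel_h_def[abs_def] Lambda_eq_phi power2_csqrt
      by (intro holomorphic_intros holomorphic_phi)
    show "bessel_h \<nu> z \<noteq> 0 \<and> \<beta> < Re (z * deriv (bessel_h \<nu>) z / bessel_h \<nu> z)"
      if z: "norm z < r" "z \<noteq> 0" for z
      using bessel_h_log_deriv[of z] Re_p_less[OF z(1) r(2)] z r by simp
    show "Re (of_real r * deriv (bessel_h \<nu>) (of_real r) / bessel_h \<nu> (of_real r)) \<le> \<beta>"
      using bessel_h_log_deriv(2)[of "of_real r"] r by simp
  qed (use r assms in auto)
  moreover have "smallest_pos_root (\<lambda>z. z * deriv (bessel_J \<nu>) z + of_real (2 - 2 * \<beta> - \<nu>) * bessel_J \<nu> z) (sqrt r)"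
    by (rule J_smallest_root[OF r]) simp
  ultimately show ?thesis
    using r by (intro exI[of _ "sqrt r"]) simp
qed

lemma radius_f_pos_order:
  assumes "\<beta> < 1" "0 < \<nu>"
  shows "\<exists>x. smallest_pos_root (\<lambda>z. z * deriv (bessel_J \<nu>) z - of_real (\<beta> * \<nu>) * bessel_J \<nu> z) x \<and>
    starlike_radius \<beta> (bessel_f \<nu>) = ereal x"
proof -
  \<comment> \<open>Solves \<open>1 - 2 / \<nu> * \<tau> = \<beta>\<close>; the same value satisfies
    \<open>\<nu> + a = 2 * \<tau>\<close> for \<open>a = - \<beta> * \<nu>\<close>.\<close>
  define \<tau> where "\<tau> = \<nu> * (1 - \<beta>) / 2"
  have \<tau>: "2 / \<nu> * \<tau> = 1 - \<beta>"
    using assms by (simp add: \<tau>_def)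
  obtain r where r: "0 < r" "r < R" "p (of_real r) = of_real \<tau>"
    using p_attains[of \<tau>] assms by (auto simp: \<tau>_def)
  have log_deriv: "Re (z * deriv (bessel_f \<nu>) z / bessel_f \<nu> z) = 1 - 2 / \<nu> * Re (p (z\<^sup>2))"
    if "z \<noteq> 0" "norm z < sqrt R" for z
    using bessel_f_log_deriv(2)[OF that] by simp
  have "starlike_radius \<beta> (bessel_f \<nu>) = ereal (sqrt r)"
  proof (rule starlike_radius_eqI)
    show "bessel_f \<nu> holomorphic_on ball 0 (sqrt r)"
      using holomorphic_bessel_f by (rule holomorphic_on_subset) (use r in \<open>simp add: subset_ball\<close>)
    show "bessel_f \<nu> z \<noteq> 0 \<and> \<beta> < Re (z * deriv (bessel_f \<nu>) z / bessel_f \<nu> z)"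
      if z: "norm z < sqrt r" "z \<noteq> 0" for z
    proof -
      have *: "norm z < sqrt R"
        using z r by (meson less_trans real_sqrt_less_iff)
      have "Re (p (z\<^sup>2)) < \<tau>"
        using Re_p_less[OF norm_square_less[OF z(1)] r(2)] r(3) by simp
      then have "2 / \<nu> * Re (p (z\<^sup>2)) < 2 / \<nu> * \<tau>"
        using assms by (intro mult_strict_left_mono) auto
      then show ?thesis
        using bessel_f_log_deriv(1)[OF z(2) *] log_deriv[OF z(2) *] \<tau> by simp
    qed
    show "Re (of_real (sqrt r) * deriv (bessel_f \<nu>) (of_real (sqrt r)) / bessel_f \<nu> (of_real (sqrt r))) \<le> \<beta>"
      using log_deriv[of "of_real (sqrt r)"] r \<tau> by (simp flip: of_real_power)
  qed (use r assms in auto)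
  moreover have "smallest_pos_root (\<lambda>z. z * deriv (bessel_J \<nu>) z + of_real (- \<beta> * \<nu>) * bessel_J \<nu> z) (sqrt r)"
    by (rule J_smallest_root[OF r]) (simp add: \<tau>_def algebra_simps)
  ultimately show ?thesis by auto
qed

lemma radius_f_neg_order:
  assumes "0 \<le> \<beta>" "\<beta> < 1" "\<nu> < 0"
  shows "\<exists>x. unique_pos_root (\<lambda>z. z * deriv (bessel_I \<nu>) z - of_real (\<beta> * \<nu>) * bessel_I \<nu> z) x \<and>
    starlike_radius \<beta> (bessel_f \<nu>) = ereal x"
proof -
  \<comment> \<open>For negative \<nu> the condition \<open>1 - 2 / \<nu> * Re p > \<beta>\<close>
    becomes the lower bound \<open>Re p > - k\<close>, and \<open>\<beta> \<ge> 0\<close> keeps the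
    level \<open>- k\<close> at or above \<open>\<nu> / 2\<close>.\<close>
  define k where "k = - \<nu> * (1 - \<beta>) / 2"
  have k: "0 < k" "k < 1 / 2" "2 * k \<le> - \<nu>"
  proof -
    show "0 < k" using assms by (simp add: k_def mult_neg_pos)
    have "- \<nu> * (1 - \<beta>) \<le> - \<nu> * 1"
      using assms by (intro mult_left_mono) auto
    then show "2 * k \<le> - \<nu>" by (simp add: k_def)
    then show "k < 1 / 2" using order by simp
  qed
  have k': "2 / \<nu> * (- k) = 1 - \<beta>"
    using assms by (simp add: k_def)
  obtain r where r: "0 < r" "r < R" "p (- of_real r) = - of_real k"
    "\<And>w. norm w < r \<Longrightarrow> - k < Re (p w)"
    using Re_p_gt_disc[OF k] by blast
  have log_deriv: "Re (z * deriv (bessel_f \<nu>) z / bessel_f \<nu> z) = 1 - 2 / \<nu> * Re (p (z\<^sup>2))"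
    if "z \<noteq> 0" "norm z < sqrt R" for z
    using bessel_f_log_deriv(2)[OF that] by simp
  have "starlike_radius \<beta> (bessel_f \<nu>) = ereal (sqrt r)"
  proof (rule starlike_radius_eqI)
    show "bessel_f \<nu> holomorphic_on ball 0 (sqrt r)"
      using holomorphic_bessel_f by (rule holomorphic_on_subset) (use r in \<open>simp add: subset_ball\<close>)
    show "bessel_f \<nu> z \<noteq> 0 \<and> \<beta> < Re (z * deriv (bessel_f \<nu>) z / bessel_f \<nu> z)"
      if z: "norm z < sqrt r" "z \<noteq> 0" for z
    proof -
      have *: "norm z < sqrt R"
        using z r by (meson less_trans real_sqrt_less_iff)
      have "- k < Re (p (z\<^sup>2))"
        using r(4) norm_square_less[OF z(1)] by blast
      then have "2 / \<nu> * Re (p (z\<^sup>2)) < 2 / \<nu> * (- k)"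
        using assms by (intro mult_strict_left_mono_neg) (auto simp: divide_neg_neg divide_less_0_iff)
      then show ?thesis
        using bessel_f_log_deriv(1)[OF z(2) *] log_deriv[OF z(2) *] k' by simp
    qed
    \<comment> \<open>The extremal point is imaginary because its square must be
      \<open>- r\<close>.\<close>
    show "Re ((\<i> * of_real (sqrt r)) * deriv (bessel_f \<nu>) (\<i> * of_real (sqrt r)) /
        bessel_f \<nu> (\<i> * of_real (sqrt r))) \<le> \<beta>"
    proof -
      have "(\<i> * of_real (sqrt r))\<^sup>2 = - complex_of_real r"
        using r by (simp add: power_mult_distrib flip: of_real_power)
      then show ?thesis
        using log_deriv[of "\<i> * of_real (sqrt r)"] r k' by (simp add: norm_mult)
    qed
  qed (use r assms in \<open>auto simp: norm_mult\<close>)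
  moreover have "unique_pos_root (\<lambda>z. z * deriv (bessel_I \<nu>) z + of_real (- \<beta> * \<nu>) * bessel_I \<nu> z) (sqrt r)"
  proof (rule I_unique_root[OF r(1,3) k(1)])
    show "k + \<nu> < 0"
      using k assms by linarith
    show "\<nu> + - \<beta> * \<nu> = - 2 * k"
      by (simp add: k_def algebra_simps)
  qed
  ultimately show ?thesis by auto
qed

end

theorem theorem1:
  fixes \<beta> \<nu> :: real
  assumes "0 \<le> \<beta>" and "\<beta> < 1"
  shows
    "(\<nu> \<in> {-1<..<0} \<longrightarrow>
        (\<exists>x. unique_pos_root
               (\<lambda>z. z * deriv (bessel_I \<nu>) z - of_real (\<beta> * \<nu>) * bessel_I \<nu> z) x \<and>
             starlike_radius \<beta> (bessel_f \<nu>) = ereal x)) \<and>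
     (\<nu> > 0 \<longrightarrow>
        (\<exists>x. smallest_pos_root
               (\<lambda>z. z * deriv (bessel_J \<nu>) z - of_real (\<beta> * \<nu>) * bessel_J \<nu> z) x \<and>
             starlike_radius \<beta> (bessel_f \<nu>) = ereal x)) \<and>
     (\<nu> > -1 \<longrightarrow>
        (\<exists>y. smallest_pos_root
               (\<lambda>z. z * deriv (bessel_J \<nu>) z + of_real (1 - \<beta> - \<nu>) * bessel_J \<nu> z) y \<and>
             starlike_radius \<beta> (bessel_g \<nu>) = ereal y)) \<and>
     (\<nu> > -1 \<longrightarrow>
        (\<exists>z1. smallest_pos_root
               (\<lambda>z. z * deriv (bessel_J \<nu>) z + of_real (2 - 2 * \<beta> - \<nu>) * bessel_J \<nu> z) z1 \<and>
             starlike_radius \<beta> (bessel_h \<nu>) = ereal (z1\<^sup>2)))"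
proof (intro conjI impI)
  assume "\<nu> \<in> {-1<..<0}"
  then interpret bessel_order \<nu> by unfold_locales simp
  show "\<exists>x. unique_pos_root (\<lambda>z. z * deriv (bessel_I \<nu>) z - of_real (\<beta> * \<nu>) * bessel_I \<nu> z) x \<and>
      starlike_radius \<beta> (bessel_f \<nu>) = ereal x"
    using radius_f_neg_order assms \<open>\<nu> \<in> {-1<..<0}\<close> by simp
next
  assume "\<nu> > 0"
  then interpret bessel_order \<nu> by unfold_locales simp
  show "\<exists>x. smallest_pos_root (\<lambda>z. z * deriv (bessel_J \<nu>) z - of_real (\<beta> * \<nu>) * bessel_J \<nu> z) x \<and>
      starlike_radius \<beta> (bessel_f \<nu>) = ereal x"
    by (rule radius_f_pos_order[OF \<open>\<beta> < 1\<close> \<open>\<nu> > 0\<close>])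
next
  assume "\<nu> > -1"
  then interpret bessel_order \<nu> by unfold_locales
  show "\<exists>y. smallest_pos_root
      (\<lambda>z. z * deriv (bessel_J \<nu>) z + of_real (1 - \<beta> - \<nu>) * bessel_J \<nu> z) y \<and>
      starlike_radius \<beta> (bessel_g \<nu>) = ereal y"
    by (rule radius_g[OF \<open>\<beta> < 1\<close>])
  show "\<exists>z1. smallest_pos_root
      (\<lambda>z. z * deriv (bessel_J \<nu>) z + of_real (2 - 2 * \<beta> - \<nu>) * bessel_J \<nu> z) z1 \<and>
      starlike_radius \<beta> (bessel_h \<nu>) = ereal (z1\<^sup>2)"
    by (rule radius_h[OF \<open>\<beta> < 1\<close>])
qed

end
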